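(* Let $\chi(x)=\bigl(\mu(x)/\widehat\mu(x)\bigr)^{1/2}$ for $x\in\mathcal X$. For any $x,y\in\operatorname{supp}(\mathrm P)$ and any integer $m>0$, \[ \bigl\lvert \widehat K_{2m}(x,y)-\overline K_{2m}(x,y)\bigr\rvert\le \frac{\max\{1,\lVert\chi\rVert_\infty\}^2}{\mu(x)^{1/2}\mu(y)^{1/2}}\Bigl((2m-1)\lVert\widehat{\mathcal Q}-\mathcal G\rVert_\infty\bigl(1+\lVert\widehat{\mathcal Q}-\mathcal G\rVert_\infty\bigr)^{2m-2}+2\lVert\chi-1\rVert_\infty\Bigr) \] and \[ \bigl\lVert \widehat K_{2m}(x,\cdot)-\overline K_{2m}(x,\cdot)\bigr\rVert_{L^2_{\mathrm P}}\le \frac{\max\{1,\lVert\chi\rVert_\infty\}^2}{\mu(x)^{1/2}}\Bigl((2m-1)\lVert\widehat{\mathcal Q}-\mathcal G\rVert_\infty\bigl(1+\lVert\widehat{\mathcal Q}-\mathcal G\rVert_\infty\bigr)^{2m-2}+2\lVert\chi-1\rVert_\infty\Bigr). \]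
   Context: Setting: $\mathcal X$ is a compact subset of a separable Hilbert space, $\mathrm P$ is a Borel probability measure on $\mathcal X$ whose support is a union of several compact connected components, $\beta>0$, and $K(x,y)=\exp(-\beta\|x-y\|^2)$ for $x,y\in\mathcal X$. $\mathcal H$ is the reproducing kernel Hilbert space of $K$, with feature map $\phi_K:\mathcal X\to\mathcal H$, $K(x,y)=\langle\phi_K(x),\phi_K(y)\rangle_{\mathcal H}$. Ideal objects: $\mu(x)=\int K(x,z)\,\mathrm d\mathrm P(z)$, $\phi_{\overline K}(x)=\mu(x)^{-1/2}\phi_K(x)$, $\overline K(x,y)=\mu(x)^{-1/2}K(x,y)\mu(y)^{-1/2}$; for integer $m\ge1$, \[ \overline K_m(x,y)=\int \overline K(y,z_1)\overline K(z_1,z_2)\cdots\overline K(z_{m-1},x)\,\mathrm d\mathrm P^{\otimes(m-1)}(z_1,\dots,z_{m-1}),\quad \overline K_1=\overline K; \] and $\mathcal G:\mathcal H\to\mathcal H$, $\mathcal G v=\int\langle v,\phi_{\overline K}(z)\rangle_{\mathcal H}\,\phi_{\overline K}(z)\,\mathrm d\mathrm P(z)$. Empirical objects: $X_1,\dots,X_n\in\mathcal X$ is an i.i.d. sample drawn according to $\mathrm P$; $\widehat\mu(x)=\frac1n\sum_{i=1}^nK(x,X_i)$, $\phi_{\widehat K}(x)=\widehat\mu(x)^{-1/2}\phi_K(x)$, \[ \widehat{\mathcal Q}v=\frac1n\sum_{i=1}^n\widehat\mu(X_i)^{-1}\langle v,\phi_K(X_i)\rangle_{\mathcal H}\,\phi_K(X_i),\qquad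 v\in\mathcal H, \] and for integer $m\ge1$, $\widehat K_m(x,y)=\bigl\langle\widehat{\mathcal Q}^{\frac{m-1}{2}}\phi_{\widehat K}(x),\widehat{\mathcal Q}^{\frac{m-1}{2}}\phi_{\widehat K}(y)\bigr\rangle_{\mathcal H}$ (powers of the positive self-adjoint operator $\widehat{\mathcal Q}$ by functional calculus). Norms: $\lVert\cdot\rVert_\infty$ is the operator norm for operators on $\mathcal H$ and the supremum norm over $\mathcal X$ for functions on $\mathcal X$. *)

theory Defs
  imports "HOL-Probability.Probability" "HOL-Computational_Algebra.Polynomial"
begin

definition op_power :: "('h::real_normed_vector \<Rightarrow>\<^sub>L 'h) \<Rightarrow> nat \<Rightarrow> ('h \<Rightarrow>\<^sub>L 'h)" where
  "op_power A k = ((\<lambda>B. A o\<^sub>L B) ^^ k) id_blinfun"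

definition op_poly :: "real poly \<Rightarrow> ('h::real_normed_vector \<Rightarrow>\<^sub>L 'h) \<Rightarrow> ('h \<Rightarrow>\<^sub>L 'h)" where
  "op_poly p A = (\<Sum>i\<le>degree p. coeff p i *\<^sub>R op_power A i)"

text \<open>
  For self-adjoint operators on a real Hilbert space the real spectrum defined here is the
  spectrum of the complexification.
\<close>

definition op_spectrum :: "('h::real_normed_vector \<Rightarrow>\<^sub>L 'h) \<Rightarrow> real set" where
  "op_spectrum A = {t. \<not> (\<exists>B. B o\<^sub>L (A - t *\<^sub>R id_blinfun) = id_blinfun \<and>
                              (A - t *\<^sub>R id_blinfun) o\<^sub>L B = id_blinfun)}"

text \<open>
  Continuous functional calculus: \<open>f(A)\<close> is the norm limit of \<open>p\<^sub>j(A)\<close> along any polynomials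
  \<open>p\<^sub>j\<close> converging to \<open>f\<close> uniformly on the spectrum.  It is meaningful for self-adjoint \<open>A\<close> and
  \<open>f\<close> continuous on the spectrum, where the limit exists and does not depend on the polynomials.
\<close>

definition fun_calc :: "(real \<Rightarrow> real) \<Rightarrow> ('h::real_normed_vector \<Rightarrow>\<^sub>L 'h) \<Rightarrow> ('h \<Rightarrow>\<^sub>L 'h)" where
  "fun_calc f A = (THE B. \<forall>p :: nat \<Rightarrow> real poly.
     uniform_limit (op_spectrum A) (\<lambda>j. poly (p j)) f sequentially \<longrightarrow>
     (\<lambda>j. op_poly (p j) A) \<longlonglongrightarrow> B)"

text \<open>
  The power \<open>A\<^sup>k\<^sup>/\<^sup>2\<close> of a positive operator.  The function \<open>t \<mapsto> t\<^sup>k\<^sup>/\<^sup>2\<close> is written with \<open>sqrt\<close>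
  because \<open>0 powr 0 = 0\<close>, whereas \<open>A\<^sup>0\<close> has to be the identity.
\<close>

definition op_half_power :: "('h::real_normed_vector \<Rightarrow>\<^sub>L 'h) \<Rightarrow> nat \<Rightarrow> ('h \<Rightarrow>\<^sub>L 'h)" where
  "op_half_power A k = fun_calc (\<lambda>t. sqrt t ^ k) A"

definition measure_support :: "'a::topological_space measure \<Rightarrow> 'a set" where
  "measure_support P =
     {x \<in> space P. \<forall>U. open U \<longrightarrow> x \<in> U \<longrightarrow> emeasure P (U \<inter> space P) > 0}"

text \<open>
  The next two are real-valued and hence norms only for bounded and for square-integrable
  functions, respectively.
\<close>

definition sup_norm :: "'a set \<Rightarrow> ('a \<Rightarrow> real) \<Rightarrow> real" where
  "sup_norm S f = (SUP x\<in>S. \<bar>f x\<bar>)"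

definition L2_norm :: "'a measure \<Rightarrow> ('a \<Rightarrow> real) \<Rightarrow> real" where
  "L2_norm P f = sqrt (LINT x|P. (f x)\<^sup>2)"

text \<open>
  The Hilbert space of functions on \<open>S\<close> is represented by an abstract Hilbert space \<open>'h\<close>
  together with \<open>\<iota>\<close>, where \<open>\<iota> v\<close> is the function on \<open>S\<close> that the vector \<open>v\<close> stands for
  (values outside \<open>S\<close> are irrelevant).  The second condition says that \<open>v\<close> is determined by
  this function; the last two say that \<open>\<phi> x\<close> stands for \<open>K x\<close> and has the reproducing property.
\<close>

definition is_rkhs ::
  "'a set \<Rightarrow> ('a \<Rightarrow> 'a \<Rightarrow> real) \<Rightarrow> ('h::{real_inner,banach} \<Rightarrow> 'a \<Rightarrow> real) \<Rightarrow> ('a \<Rightarrow> 'h) \<Rightarrow> bool"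
where
  "is_rkhs S K \<iota> \<phi> \<longleftrightarrow>
     (\<forall>x\<in>S. linear (\<lambda>v. \<iota> v x)) \<and>
     (\<forall>v w. (\<forall>x\<in>S. \<iota> v x = \<iota> w x) \<longrightarrow> v = w) \<and>
     (\<forall>x\<in>S. \<forall>y\<in>S. \<iota> (\<phi> x) y = K x y) \<and>
     (\<forall>x\<in>S. \<forall>v. \<iota> v x = v \<bullet> \<phi> x)"

lemma is_rkhs_kernel:
  assumes "is_rkhs S K \<iota> \<phi>" "x \<in> S" "y \<in> S"
  shows "K x y = \<phi> x \<bullet> \<phi> y"
  using assms by (metis is_rkhs_def)

definition gauss_kernel :: "real \<Rightarrow> 'a::real_inner \<Rightarrow> 'a \<Rightarrow> real" where
  "gauss_kernel \<beta> x y = exp (- \<beta> * (norm (x - y))\<^sup>2)"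

definition normalized_feature ::
  "('a \<Rightarrow> real) \<Rightarrow> ('a \<Rightarrow> 'h::real_vector) \<Rightarrow> 'a \<Rightarrow> 'h" where
  "normalized_feature w \<phi> x = (1 / sqrt (w x)) *\<^sub>R \<phi> x"

definition ideal_mu :: "('a \<Rightarrow> 'a \<Rightarrow> real) \<Rightarrow> 'a measure \<Rightarrow> 'a \<Rightarrow> real" where
  "ideal_mu K P x = (LINT z|P. K x z)"

definition ideal_kernel :: "('a \<Rightarrow> 'a \<Rightarrow> real) \<Rightarrow> 'a measure \<Rightarrow> 'a \<Rightarrow> 'a \<Rightarrow> real" where
  "ideal_kernel K P x y = K x y / (sqrt (ideal_mu K P x) * sqrt (ideal_mu K P y))"

text \<open>
  The integration variables \<open>z 1, \<dots>, z (m - 1)\<close> are extended by the end points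
  \<open>z 0 = y\<close> and \<open>z m = x\<close>.
\<close>

definition ideal_kernel_iter ::
  "('a \<Rightarrow> 'a \<Rightarrow> real) \<Rightarrow> 'a measure \<Rightarrow> nat \<Rightarrow> 'a \<Rightarrow> 'a \<Rightarrow> real" where
  "ideal_kernel_iter K P m x y =
     (LINT z|PiM {1..<m} (\<lambda>_. P).
        (let w = z(0 := y, m := x) in (\<Prod>i<m. ideal_kernel K P (w i) (w (Suc i)))))"

text \<open>
  \<open>Blinfun\<close> is unspecified on maps that are not bounded linear; the map below is bounded linear
  for a bounded continuous positive definite kernel with \<open>ideal_mu\<close> bounded away from \<open>0\<close>.
\<close>

definition ideal_op ::
  "('a \<Rightarrow> 'a \<Rightarrow> real) \<Rightarrow> ('a \<Rightarrow> 'h) \<Rightarrow> 'a measure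
     \<Rightarrow> ('h::{real_inner,banach,second_countable_topology} \<Rightarrow>\<^sub>L 'h)" where
  "ideal_op K \<phi> P = Blinfun (\<lambda>v. LINT z|P.
     (v \<bullet> normalized_feature (ideal_mu K P) \<phi> z) *\<^sub>R normalized_feature (ideal_mu K P) \<phi> z)"

definition emp_mu :: "('a \<Rightarrow> 'a \<Rightarrow> real) \<Rightarrow> nat \<Rightarrow> (nat \<Rightarrow> 'a) \<Rightarrow> 'a \<Rightarrow> real" where
  "emp_mu K n X x = (1 / real n) * (\<Sum>i=1..n. K x (X i))"

definition emp_op ::
  "('a \<Rightarrow> 'a \<Rightarrow> real) \<Rightarrow> ('a \<Rightarrow> 'h) \<Rightarrow> nat \<Rightarrow> (nat \<Rightarrow> 'a) \<Rightarrow> ('h::real_inner \<Rightarrow>\<^sub>L 'h)" where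
  "emp_op K \<phi> n X = Blinfun (\<lambda>v. (1 / real n) *\<^sub>R
     (\<Sum>i=1..n. ((1 / emp_mu K n X (X i)) * (v \<bullet> \<phi> (X i))) *\<^sub>R \<phi> (X i)))"

lemma emp_op_apply:
  "blinfun_apply (emp_op K \<phi> n X) v = (1 / real n) *\<^sub>R
     (\<Sum>i=1..n. ((1 / emp_mu K n X (X i)) * (v \<bullet> \<phi> (X i))) *\<^sub>R \<phi> (X i))"
  unfolding emp_op_def
  by (subst bounded_linear_Blinfun_apply)
     (intro bounded_linear_intros bounded_linear_sum bounded_linear_inner_left, rule refl)

definition emp_kernel_iter ::
  "('a \<Rightarrow> 'a \<Rightarrow> real) \<Rightarrow> ('a \<Rightarrow> 'h::real_inner) \<Rightarrow> nat \<Rightarrow> (nat \<Rightarrow> 'a) \<Rightarrow> nat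
     \<Rightarrow> 'a \<Rightarrow> 'a \<Rightarrow> real" where
  "emp_kernel_iter K \<phi> n X m x y =
     blinfun_apply (op_half_power (emp_op K \<phi> n X) (m - 1))
       (normalized_feature (emp_mu K n X) \<phi> x) \<bullet>
     blinfun_apply (op_half_power (emp_op K \<phi> n X) (m - 1))
       (normalized_feature (emp_mu K n X) \<phi> y)"

end

theory Submission
  imports Defs "HOL-Computational_Algebra.Fundamental_Theorem_Algebra"
begin

text \<open>
  Since \<open>Q\<close> is positive and of finite rank, the functional calculus reduces to polynomials in \<open>Q\<close>
  and the empirical kernel of order \<open>2 m\<close> is the form of \<open>Q\<^sup>2\<^sup>m\<^sup>-\<^sup>1\<close> at empirical features, which are
  \<open>chi\<close> times the ideal ones; Fubini makes the ideal kernel the form of \<open>G\<^sup>2\<^sup>m\<^sup>-\<^sup>1\<close> at ideal features.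
  The two terms of the bound come from replacing \<open>Q\<^sup>2\<^sup>m\<^sup>-\<^sup>1\<close> by \<open>G\<^sup>2\<^sup>m\<^sup>-\<^sup>1\<close>, by telescoping with
  \<open>norm G \<le> 1\<close> (Schur's test), and \<open>chi\<close> by \<open>1\<close>.  Pointwise, one factor \<open>\<mu>\<^sup>-\<^sup>1\<^sup>/\<^sup>2\<close> is the norm of the
  feature at \<open>y\<close>; in \<open>L\<^sup>2\<close> it disappears, because the \<open>L\<^sup>2\<close> norm of the pairing of \<open>v\<close> with the ideal
  features is the square root of \<open>G v \<bullet> v\<close>, hence at most \<open>norm v\<close>.
\<close>

section \<open>Polynomials in an operator\<close>

lemma op_power_0 [simp]: "op_power A 0 = id_blinfun"
  by (simp add: op_power_def)

lemma op_power_Suc [simp]: "op_power A (Suc k) = A o\<^sub>L op_power A k"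
  by (simp add: op_power_def)

lemma op_power_Suc_apply: "op_power A (Suc k) v = op_power A k (A v)"
  by (induction k arbitrary: v) auto

text \<open>The degree of \<open>pCons a p\<close> depends on whether \<open>p\<close> is
  \<open>0\<close>; padding with vanishing coefficients gives one range of summation for both
  cases.\<close>

lemma op_poly_apply_le:
  assumes "degree p \<le> n"
  shows "op_poly p A v = (\<Sum>i\<le>n. coeff p i *\<^sub>R op_power A i v)"
proof -
  have "op_poly p A v = (\<Sum>i\<le>degree p. coeff p i *\<^sub>R op_power A i v)"
    by (simp add: op_poly_def blinfun.sum_left blinfun.scaleR_left)
  also have "\<dots> = (\<Sum>i\<le>n. coeff p i *\<^sub>R op_power A i v)"
    using assms by (intro sum.mono_neutral_left) (auto simp: coeff_eq_0)
  finally show ?thesis .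
qed

lemma op_poly_0 [simp]: "op_poly 0 A = 0"
  by (simp add: op_poly_def)

lemma op_poly_pCons_apply [simp]: "op_poly (pCons a p) A v = a *\<^sub>R v + A (op_poly p A v)"
proof -
  have "op_poly (pCons a p) A v =
      (\<Sum>i\<le>Suc (degree p). coeff (pCons a p) i *\<^sub>R op_power A i v)"
    by (intro op_poly_apply_le degree_pCons_le)
  also have "\<dots> = a *\<^sub>R v + A (\<Sum>i\<le>degree p. coeff p i *\<^sub>R op_power A i v)"
    by (simp add: sum.atMost_Suc_shift blinfun.sum_right blinfun.scaleR_right
        del: sum.atMost_Suc)
  finally show ?thesis
    by (simp add: op_poly_apply_le[OF order_refl])
qed

lemma op_poly_add: "op_poly (p + q) A = op_poly p A + op_poly q A"
proof (rule blinfun_eqI)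
  fix v
  show "op_poly (p + q) A v = (op_poly p A + op_poly q A) v"
  proof (induction p arbitrary: q)
    case 0
    show ?case by simp
  next
    case (pCons a p)
    show ?case
      by (cases q) (simp add: pCons.IH blinfun.bilinear_simps scaleR_add_left)
  qed
qed

lemma op_poly_smult: "op_poly (smult c p) A = c *\<^sub>R op_poly p A"
proof (rule blinfun_eqI)
  fix v
  show "op_poly (smult c p) A v = (c *\<^sub>R op_poly p A) v"
    by (induction p) (simp_all add: blinfun.bilinear_simps algebra_simps)
qed

lemma op_poly_diff: "op_poly (p - q) A = op_poly p A - op_poly q A"
  using op_poly_add[of "p - q" q A] by simp

lemma op_poly_sum: "op_poly (\<Sum>i\<in>I. p i) A = (\<Sum>i\<in>I. op_poly (p i) A)"
  by (induction I rule: infinite_finite_induct) (simp_all add: op_poly_add)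

text \<open>With linearity this makes evaluation at \<open>A\<close> an algebra homomorphism, so
  divisibility and commutativity pass from polynomials to operators.\<close>

lemma op_poly_mult: "op_poly (p * q) A = op_poly p A o\<^sub>L op_poly q A"
proof (rule blinfun_eqI)
  fix v
  show "op_poly (p * q) A v = (op_poly p A o\<^sub>L op_poly q A) v"
    by (induction p) (simp_all add: op_poly_add op_poly_smult blinfun.bilinear_simps)
qed

lemma op_poly_commute: "op_poly p A (op_poly q A v) = op_poly q A (op_poly p A v)"
  using op_poly_mult[of p q A] op_poly_mult[of q p A]
  by (metis blinfun_apply_blinfun_compose mult.commute)

lemma op_poly_1 [simp]: "op_poly 1 A = id_blinfun"
  by (rule blinfun_eqI) (simp add: one_pCons)

lemma op_poly_monom: "op_poly (monom c k) A = c *\<^sub>R op_power A k"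
proof (rule blinfun_eqI)
  fix v
  show "op_poly (monom c k) A v = (c *\<^sub>R op_power A k) v"
    by (induction k) (simp_all add: monom_0 monom_Suc blinfun.bilinear_simps)
qed

lemma op_poly_linear: "op_poly [:- t, 1:] A = A - t *\<^sub>R id_blinfun"
  by (rule blinfun_eqI) (simp add: blinfun.bilinear_simps)

lemma op_poly_dvd_eq_0:
  assumes "p dvd q" "op_poly p A = 0"
  shows "op_poly q A = 0"
  using assms by (auto simp: dvd_def op_poly_mult)

section \<open>Operators annihilated by a polynomial\<close>

text \<open>The images of \<open>s\<close> under successive powers of \<open>A\<close> lie in a span
  of \<open>card S\<close> vectors, so \<open>card S + 1\<close> of them satisfy a linear relation.
  The sequence starts at \<open>A s\<close> because \<open>s\<close> itself may lie outside the
  span.\<close>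

lemma finite_rank_annihilating_vector:
  fixes A :: "'h::real_normed_vector \<Rightarrow>\<^sub>L 'h"
  assumes "finite S" and range: "\<And>v. A v \<in> span S"
  shows "\<exists>p. p \<noteq> 0 \<and> op_poly p A s = 0"
proof -
  define w where "w k = op_power A (Suc k) s" for k
  define N where "N = card S"
  have span: "w k \<in> span S" for k
    by (simp add: w_def range)
  show ?thesis
  \<comment> \<open>Linear dependence is a property of sets, so a repetition among the
    \<open>w k\<close> is treated apart: it gives a difference of two monomials.\<close>
  proof (cases "inj_on w {..N}")
    case False
    then obtain i j where ij: "i \<noteq> j" "w i = w j"
      by (auto simp: inj_on_def)
    define p :: "real poly" where "p = monom 1 (Suc i) - monom 1 (Suc j)"
    have "coeff p (Suc i) = 1"
      using ij by (simp add: p_def coeff_diff)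
    then have "p \<noteq> 0"
      by auto
    moreover have "op_poly p A s = 0"
      using ij by (simp add: p_def op_poly_diff op_poly_monom blinfun.bilinear_simps w_def)
    ultimately show ?thesis by blast
  next
    case True
    have "dependent (w ` {..N})"
    proof (rule ccontr)
      assume "\<not> dependent (w ` {..N})"
      then have "card (w ` {..N}) \<le> card S"
        using independent_span_bound[OF \<open>finite S\<close>] span by blast
      then show False
        using card_image[OF True] by (simp add: N_def)
    qed
    then obtain T u where T: "T \<subseteq> w ` {..N}" "(\<Sum>v\<in>T. u v *\<^sub>R v) = 0"
      and u: "\<exists>v\<in>T. u v \<noteq> 0"
      by (auto simp: dependent_explicit)
    define I where "I = {k\<in>{..N}. w k \<in> T}"
    have "T = w ` I" "inj_on w I"
      using T True by (auto simp: I_def inj_on_def)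
    define p where "p = (\<Sum>k\<in>I. monom (u (w k)) (Suc k))"
    obtain j where j: "j \<in> I" "u (w j) \<noteq> 0"
      using u \<open>T = w ` I\<close> by auto
    have "coeff p (Suc j) = (\<Sum>k\<in>I. if k = j then u (w k) else 0)"
      unfolding p_def coeff_sum by (intro sum.cong) auto
    also have "\<dots> = u (w j)"
      using j by (simp add: I_def)
    finally have "p \<noteq> 0"
      using j by auto
    moreover have "op_poly p A s = (\<Sum>k\<in>I. u (w k) *\<^sub>R w k)"
      by (simp add: p_def op_poly_sum op_poly_monom blinfun.bilinear_simps w_def)
    moreover have "\<dots> = 0"
      using T \<open>T = w ` I\<close> \<open>inj_on w I\<close> by (simp add: sum.reindex)
    ultimately show ?thesis by auto
  qed
qed

text \<open>The product of annihilators of the spanning vectors vanishes on the range of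
  \<open>A\<close>; one more factor \<open>A\<close> makes it vanish everywhere.\<close>

lemma finite_rank_annihilating_poly:
  fixes A :: "'h::real_normed_vector \<Rightarrow>\<^sub>L 'h"
  assumes "finite S" and range: "\<And>v. A v \<in> span S"
  shows "\<exists>p. p \<noteq> 0 \<and> op_poly p A = 0"
proof -
  obtain p where p: "\<And>s. p s \<noteq> 0" "\<And>s. op_poly (p s) A s = 0"
    using finite_rank_annihilating_vector[OF assms] by metis
  define q where "q = (\<Prod>s\<in>S. p s)"
  have zero: "op_poly q A s = 0" if "s \<in> S" for s
  proof -
    have "q = (\<Prod>s\<in>S - {s}. p s) * p s"
      using that \<open>finite S\<close> by (simp add: q_def prod.remove mult.commute)
    then show ?thesis
      by (simp add: op_poly_mult p)
  qed
  have "op_poly q A v = 0" if "v \<in> span S" for v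
    using that by (induction v rule: span_induct_alt) (simp_all add: blinfun.bilinear_simps zero)
  then have "op_poly q A (A v) = 0" for v
    using range by blast
  then have "op_poly (q * monom 1 1) A = 0"
    by (intro blinfun_eqI) (simp add: op_poly_mult op_poly_monom)
  moreover have "q * monom 1 1 \<noteq> 0"
    using p \<open>finite S\<close> by (simp add: q_def)
  ultimately show ?thesis by blast
qed

section \<open>Real polynomials: factorization, simple roots and interpolation\<close>

lemma of_real_poly_add:
  "poly (map_poly of_real (p + q)) z = poly (map_poly of_real p) z + poly (map_poly of_real q) z"
  for z :: complex
proof -
  have "map_poly complex_of_real (p + q) = map_poly of_real p + map_poly of_real q"
    by (rule poly_eqI) (simp add: coeff_map_poly)
  then show ?thesis by simp
qed

lemma of_real_poly_mult:
  "poly (map_poly of_real (p * q)) z = poly (map_poly of_real p) z * poly (map_poly of_real q) z"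
  for z :: complex
  by (induction p) (simp_all add: map_poly_pCons of_real_poly_add map_poly_smult algebra_simps)

text \<open>A complex root \<open>z\<close> exists. If real, it gives a linear factor; otherwise
  \<open>z\<close> and its conjugate give \<open>(X - a)\<^sup>2 + b\<^sup>2\<close> with
  \<open>a = Re z\<close>, \<open>b = Im z\<close>, since a real remainder of degree below two with
  a nonreal root is \<open>0\<close>.\<close>

lemma real_poly_linear_or_quadratic_factor:
  fixes p :: "real poly"
  assumes "degree p > 0"
  obtains t where "[:- t, 1:] dvd p"
    | a b where "b \<noteq> 0" "[:a\<^sup>2 + b\<^sup>2, - 2 * a, 1:] dvd p"
proof -
  define cp where "cp = map_poly complex_of_real p"
  have "degree cp > 0"
    using assms by (simp add: cp_def degree_map_poly)
  then obtain z where z: "poly cp z = 0"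
    using fundamental_theorem_of_algebra[of cp] by (auto simp: constant_degree)
  show thesis
  proof (cases "Im z = 0")
    case True
    have "poly cp (of_real t) = of_real (poly p t)" for t
      unfolding cp_def by (induction p) (simp_all add: map_poly_pCons)
    moreover have "z = of_real (Re z)"
      using True by (simp add: complex_eq_iff)
    ultimately have "poly p (Re z) = 0"
      using z by (metis of_real_eq_0_iff)
    then have "[:- Re z, 1:] dvd p"
      by (simp add: poly_eq_0_iff_dvd)
    then show thesis
      by (rule that)
  next
    case False
    define q where "q = [:(Re z)\<^sup>2 + (Im z)\<^sup>2, - 2 * Re z, 1:]"
    define r where "r = p mod q"
    have "poly (map_poly of_real q) z = 0"
      by (simp add: q_def map_poly_pCons complex_eq_iff power2_eq_square algebra_simps)
    moreover have "p = q * (p div q) + r"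
      by (simp add: r_def)
    ultimately have "poly (map_poly of_real r) z = 0"
      using z by (metis cp_def of_real_poly_add of_real_poly_mult add_0 mult_zero_left)
    moreover have "degree r < 2"
      using degree_mod_less[of q p] by (auto simp: q_def r_def)
    then obtain c d where r: "r = [:c, d:]"
      using that[of "coeff r 0" "coeff r 1"]
      by (auto simp: poly_eq_iff coeff_pCons coeff_eq_0 split: nat.splits)
    ultimately have "d = 0" "c = 0"
      using False by (auto simp: map_poly_pCons complex_eq_iff)
    then have "q dvd p"
      using r by (simp add: r_def mod_eq_0_iff_dvd)
    then show thesis
      using that(2) False unfolding q_def by blast
  qed
qed

text \<open>For finite \<open>S\<close> the roots are simple, so annihilation by this polynomial
  encodes diagonalizability with eigenvalues in \<open>S\<close>.\<close>

definition root_poly :: "real set \<Rightarrow> real poly" where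
  "root_poly S = (\<Prod>s\<in>S. [:- s, 1:])"

lemma poly_root_poly: "finite S \<Longrightarrow> poly (root_poly S) t = 0 \<longleftrightarrow> t \<in> S"
  by (auto simp: root_poly_def poly_prod)

lemma root_poly_insert:
  "finite S \<Longrightarrow> t \<notin> S \<Longrightarrow> root_poly (insert t S) = [:- t, 1:] * root_poly S"
  by (simp add: root_poly_def)

lemma root_poly_remove:
  "finite S \<Longrightarrow> t \<in> S \<Longrightarrow> root_poly S = [:- t, 1:] * root_poly (S - {t})"
  by (simp add: root_poly_def prod.remove)

lemma root_poly_dvd:
  assumes "finite S" "\<And>s. s \<in> S \<Longrightarrow> poly q s = 0"
  shows "root_poly S dvd q"
  using assms
proof (induction S arbitrary: q)
  case empty
  show ?case by (simp add: root_poly_def)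
next
  case (insert t S)
  then obtain r where r: "q = [:- t, 1:] * r"
    by (metis dvd_def insertI1 poly_eq_0_iff_dvd)
  have "poly r s = 0" if "s \<in> S" for s
    using insert.prems[of s] insert.hyps that by (auto simp: r)
  then have "root_poly S dvd r"
    by (rule insert.IH)
  then show ?case
    using insert.hyps by (simp add: root_poly_insert r del: mult_pCons_left)
qed

text \<open>Newton interpolation: \<open>root_poly S\<close> vanishes at the old points but not at
  the new one, so a multiple of it corrects the value there.\<close>

lemma poly_interpolation:
  fixes f :: "real \<Rightarrow> real"
  assumes "finite S"
  shows "\<exists>p. \<forall>s\<in>S. poly p s = f s"
  using assms
proof (induction S)
  case empty
  show ?case by simp
next
  case (insert t S)
  then obtain p where p: "\<forall>s\<in>S. poly p s = f s"
    by blast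
  define c where "c = (f t - poly p t) / poly (root_poly S) t"
  have "\<forall>s\<in>insert t S. poly (p + smult c (root_poly S)) s = f s"
    using insert.hyps p by (auto simp: c_def poly_root_poly)
  then show ?case by blast
qed

section \<open>Half-integer powers of a positive algebraic operator\<close>

locale symmetric_op =
  fixes A :: "'h::real_inner \<Rightarrow>\<^sub>L 'h"
  assumes symmetric: "A v \<bullet> w = v \<bullet> A w"
begin

lemma symmetric_op_power: "op_power A k v \<bullet> w = v \<bullet> op_power A k w"
  by (induction k arbitrary: v w) (simp_all add: symmetric op_power_Suc_apply del: op_power_Suc,
      simp add: symmetric op_power_Suc_apply[symmetric])

lemma symmetric_op_poly: "op_poly p A v \<bullet> w = v \<bullet> op_poly p A w"
  by (simp add: op_poly_apply_le[OF order_refl] inner_sum_left inner_sum_right symmetric_op_power)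

text \<open>By symmetry the squared norm of \<open>(A - t) v\<close> is the pairing of
  \<open>v\<close> with \<open>(A - t)\<^sup>2 v\<close>. Thus there are no Jordan blocks, and
  multiple real roots reduce to simple ones.\<close>

lemma cancel_square:
  assumes "(A - t *\<^sub>R id_blinfun) ((A - t *\<^sub>R id_blinfun) v) = 0"
  shows "(A - t *\<^sub>R id_blinfun) v = 0"
proof -
  have "(A - t *\<^sub>R id_blinfun) v \<bullet> (A - t *\<^sub>R id_blinfun) v
      = v \<bullet> (A - t *\<^sub>R id_blinfun) ((A - t *\<^sub>R id_blinfun) v)"
    using symmetric_op_poly[of "[:- t, 1:]" v] unfolding op_poly_linear .
  then show ?thesis
    using assms by simp
qed

text \<open>The polynomial is \<open>(X - a)\<^sup>2 + b\<^sup>2\<close>; its value at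
  \<open>A\<close>, applied to \<open>v\<close> and paired with \<open>v\<close>, is
  \<open>u \<bullet> u + b\<^sup>2 * (v \<bullet> v)\<close> with
  \<open>u = A v - a *\<^sub>R v\<close>.\<close>

lemma cancel_quadratic:
  assumes "b \<noteq> 0" "op_poly [:a\<^sup>2 + b\<^sup>2, - 2 * a, 1:] A v = 0"
  shows "v = 0"
proof -
  define u where "u = A v - a *\<^sub>R v"
  have "A u - a *\<^sub>R u + b\<^sup>2 *\<^sub>R v = op_poly [:a\<^sup>2 + b\<^sup>2, - 2 * a, 1:] A v"
    by (simp add: u_def blinfun.bilinear_simps algebra_simps power2_eq_square)
      (simp flip: scaleR_add_left)
  then have "(A u - a *\<^sub>R u + b\<^sup>2 *\<^sub>R v) \<bullet> v = 0"
    using assms by simp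
  moreover have "(A u - a *\<^sub>R u) \<bullet> v = u \<bullet> (A v - a *\<^sub>R v)"
    by (simp add: inner_diff_left inner_diff_right symmetric)
  ultimately have "u \<bullet> u + b\<^sup>2 * (v \<bullet> v) = 0"
    by (simp add: inner_add_left flip: u_def)
  moreover have "0 \<le> u \<bullet> u" "0 \<le> b\<^sup>2 * (v \<bullet> v)"
    by simp_all
  ultimately have "b\<^sup>2 * (v \<bullet> v) = 0"
    by linarith
  then show ?thesis
    using assms by simp
qed

text \<open>
  Stated with a right factor \<open>C\<close> so that the induction can move linear factors of \<open>p\<close> into it.
\<close>

lemma annihilating_root_poly_aux:
  assumes "p \<noteq> 0" "op_poly p A o\<^sub>L C = 0"
  shows "\<exists>S. finite S \<and> op_poly (root_poly S) A o\<^sub>L C = 0"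
  using assms
proof (induction "degree p" arbitrary: p C rule: less_induct)
  case less
  show ?case
  proof (cases "degree p = 0")
    case True
    then obtain c where "p = [:c:]" "c \<noteq> 0"
      using less.prems(1) by (metis degree_eq_zeroE pCons_eq_0_iff)
    moreover have "op_poly p A (C v) = 0" for v
      using less.prems(2) by (metis blinfun_apply_blinfun_compose blinfun.zero_left)
    ultimately have "C v = 0" for v
      by simp
    then have "op_poly (root_poly {}) A o\<^sub>L C = 0"
      by (intro blinfun_eqI) simp
    then show ?thesis by blast
  next
    case False
    then have "degree p > 0" by simp
    then show ?thesis
    proof (cases rule: real_poly_linear_or_quadratic_factor)
      case (1 t)
      then obtain r where r: "p = r * [:- t, 1:]"
        by (metis dvd_def mult.commute)
      define D where "D = (A - t *\<^sub>R id_blinfun) o\<^sub>L C"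
      have "r \<noteq> 0"
        using r less.prems by auto
      then have "degree r < degree p"
        by (simp add: r degree_mult_eq del: mult_pCons_right)
      moreover have "op_poly r A o\<^sub>L D = 0"
        using less.prems(2) by (intro blinfun_eqI)
          (metis D_def r op_poly_mult op_poly_linear blinfun_apply_blinfun_compose)
      ultimately obtain S where S: "finite S" "op_poly (root_poly S) A o\<^sub>L D = 0"
        using less.hyps \<open>r \<noteq> 0\<close> by blast
      have zero: "op_poly (root_poly S) A ((A - t *\<^sub>R id_blinfun) (C v)) = 0" for v
        using S(2) by (metis D_def blinfun_apply_blinfun_compose blinfun.zero_left)
      show ?thesis
      proof (cases "t \<in> S")
        case False
        have "op_poly (root_poly (insert t S)) A (C v) = 0" for v
          using zero[of v] op_poly_commute[of "root_poly S" A "[:- t, 1:]"]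
          by (simp add: root_poly_insert S False op_poly_mult op_poly_linear
              del: mult_pCons_left)
        then have "op_poly (root_poly (insert t S)) A o\<^sub>L C = 0"
          by (intro blinfun_eqI) simp
        then show ?thesis
          using S by blast
      next
        \<comment> \<open>Here \<open>t\<close> would become a double root;
          \<open>cancel_square\<close> shows that the simple one already suffices.\<close>
        case True
        define q where "q = root_poly (S - {t})"
        have q: "op_poly (root_poly S) A v = (A - t *\<^sub>R id_blinfun) (op_poly q A v)" for v
          by (simp add: root_poly_remove[OF \<open>finite S\<close> True] q_def op_poly_mult op_poly_linear
              del: mult_pCons_left)
        have "(A - t *\<^sub>R id_blinfun) (op_poly q A (C v)) = 0" for v
          using zero[of v] op_poly_commute[of q A "[:- t, 1:]" "C v"]
          unfolding q op_poly_linear by (metis cancel_square)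
        then have "op_poly (root_poly S) A o\<^sub>L C = 0"
          by (intro blinfun_eqI) (simp add: q)
        then show ?thesis
          using S by blast
      qed
    next
      case (2 a b)
      then obtain r where r: "p = [:a\<^sup>2 + b\<^sup>2, - 2 * a, 1:] * r"
        by (metis dvd_def)
      have "r \<noteq> 0"
        using r less.prems by auto
      then have "degree r < degree p"
        by (simp add: r degree_mult_eq del: mult_pCons_left)
      moreover have "op_poly r A o\<^sub>L C = 0"
        using less.prems(2) by (intro blinfun_eqI)
          (metis r op_poly_mult blinfun_apply_blinfun_compose blinfun.zero_left
            cancel_quadratic[OF 2(1)])
      ultimately show ?thesis
        using less.hyps \<open>r \<noteq> 0\<close> by blast
    qed
  qed
qed

lemma annihilating_root_poly:
  assumes "p \<noteq> 0" "op_poly p A = 0"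
  shows "\<exists>S. finite S \<and> op_poly (root_poly S) A = 0"
proof -
  have "op_poly q A o\<^sub>L id_blinfun = op_poly q A" for q
    by (rule blinfun_eqI) simp
  then show ?thesis
    using annihilating_root_poly_aux[OF assms(1), of id_blinfun] assms(2) by simp
qed

text \<open>A set of least cardinality that annihilates \<open>A\<close> consists of eigenvalues.\<close>

lemma annihilating_eigenvalues:
  assumes "p \<noteq> 0" "op_poly p A = 0"
  obtains S where "finite S" "op_poly (root_poly S) A = 0"
    "\<And>s. s \<in> S \<Longrightarrow> \<exists>v. v \<noteq> 0 \<and> A v = s *\<^sub>R v"
proof -
  define Z where "Z S \<longleftrightarrow> finite S \<and> op_poly (root_poly S) A = 0" for S
  have "\<exists>S. Z S"
    using annihilating_root_poly[OF assms] by (simp add: Z_def)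
  then obtain S where S: "Z S" and min: "\<And>T. Z T \<Longrightarrow> card S \<le> card T"
    using exists_least_iff[of "\<lambda>k. \<exists>S. Z S \<and> card S = k"] by (metis not_le)
  have "\<exists>v. v \<noteq> 0 \<and> A v = s *\<^sub>R v" if s: "s \<in> S" for s
  proof -
    have "card (S - {s}) < card S"
      using S s by (simp add: Z_def card_gt_0_iff card_Diff1_less del: card_Diff_insert)
    \<comment> \<open>By minimality some \<open>w\<close> survives the other factors; its image is
      killed by the remaining factor \<open>A - s\<close> and is an eigenvector.\<close>
    then have "op_poly (root_poly (S - {s})) A \<noteq> 0"
      using S min[of "S - {s}"] by (auto simp: Z_def)
    then obtain w where w: "op_poly (root_poly (S - {s})) A w \<noteq> 0"
      by (metis blinfun_eqI blinfun.zero_left)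
    have "op_poly (root_poly S) A w = (A - s *\<^sub>R id_blinfun) (op_poly (root_poly (S - {s})) A w)"
      using S by (simp add: root_poly_remove[OF _ s] Z_def op_poly_mult op_poly_linear
          del: mult_pCons_left)
    then have "A (op_poly (root_poly (S - {s})) A w) = s *\<^sub>R op_poly (root_poly (S - {s})) A w"
      using S by (simp add: Z_def blinfun.bilinear_simps)
    then show ?thesis
      using w by blast
  qed
  then show thesis
    using that S by (auto simp: Z_def)
qed

end

section \<open>Spectrum and functional calculus of an algebraic operator\<close>

lemma eigenvalue_in_spectrum:
  fixes A :: "'h::real_normed_vector \<Rightarrow>\<^sub>L 'h"
  assumes "v \<noteq> 0" "A v = s *\<^sub>R v"
  shows "s \<in> op_spectrum A"
proof -
  have "B o\<^sub>L (A - s *\<^sub>R id_blinfun) \<noteq> id_blinfun" for B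
  proof
    assume "B o\<^sub>L (A - s *\<^sub>R id_blinfun) = id_blinfun"
    then have "B ((A - s *\<^sub>R id_blinfun) v) = v"
      by (metis blinfun_apply_blinfun_compose blinfun_apply_id_blinfun)
    then show False
      using assms by (simp add: blinfun.bilinear_simps)
  qed
  then show ?thesis
    by (auto simp: op_spectrum_def)
qed

text \<open>For \<open>t\<close> outside \<open>S\<close> let \<open>c\<close> be the nonzero value
  of \<open>root_poly S\<close> at \<open>t\<close>. Then \<open>root_poly S - c\<close> has a
  factor \<open>X - t\<close> and equals \<open>- c\<close> at \<open>A\<close>, so the cofactor
  divided by \<open>- c\<close> inverts \<open>A - t\<close>.\<close>

lemma op_spectrum_subset_roots:
  assumes "finite S" "op_poly (root_poly S) A = 0"
  shows "op_spectrum A \<subseteq> S"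
proof
  fix t
  assume t: "t \<in> op_spectrum A"
  show "t \<in> S"
  proof (rule ccontr)
    assume "t \<notin> S"
    define c where "c = poly (root_poly S) t"
    have "c \<noteq> 0"
      using \<open>t \<notin> S\<close> assms(1) by (simp add: c_def poly_root_poly)
    have "poly (root_poly S - [:c:]) t = 0"
      by (simp add: c_def)
    then obtain r where r: "root_poly S - [:c:] = [:- t, 1:] * r"
      by (metis dvd_def poly_eq_0_iff_dvd)
    define B where "B = op_poly (smult (- 1 / c) r) A"
    have "[:- t, 1:] * smult (- 1 / c) r = 1 - smult (1 / c) (root_poly S)"
    proof -
      have "[:- t, 1:] * smult (- 1 / c) r = smult (- 1 / c) (root_poly S - [:c:])"
        by (simp only: r mult_smult_right)
      also have "\<dots> = 1 - smult (1 / c) (root_poly S)"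
        using \<open>c \<noteq> 0\<close> by (simp add: smult_diff_right one_pCons)
      finally show ?thesis .
    qed
    then have "op_poly ([:- t, 1:] * smult (- 1 / c) r) A = id_blinfun"
      using assms(2) by (simp add: op_poly_diff op_poly_smult)
    then have "(A - t *\<^sub>R id_blinfun) o\<^sub>L B = id_blinfun"
      "B o\<^sub>L (A - t *\<^sub>R id_blinfun) = id_blinfun"
      by (metis B_def op_poly_linear op_poly_mult mult.commute)+
    then show False
      using t by (auto simp: op_spectrum_def)
  qed
qed

text \<open>On a finite spectrum uniform convergence is pointwise, and a Lagrange basis expresses
  \<open>op_poly q A\<close> through the values of \<open>q\<close> on \<open>S\<close>
  alone.\<close>

lemma fun_calc_eq_op_poly:
  assumes S: "finite S" "op_poly (root_poly S) A = 0" "op_spectrum A = S"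
    and g: "\<And>s. s \<in> S \<Longrightarrow> poly g s = f s"
  shows "fun_calc f A = op_poly g A"
  unfolding fun_calc_def
proof (rule the_equality)
  show "\<forall>p. uniform_limit (op_spectrum A) (\<lambda>j. poly (p j)) f sequentially \<longrightarrow>
      (\<lambda>j. op_poly (p j) A) \<longlonglongrightarrow> op_poly g A"
  proof (intro allI impI)
    fix p :: "nat \<Rightarrow> real poly"
    assume lim: "uniform_limit (op_spectrum A) (\<lambda>j. poly (p j)) f sequentially"
    have "\<forall>s. \<exists>q. \<forall>t\<in>S. poly q t = (if t = s then 1 else 0)"
      using poly_interpolation[OF S(1)] by (rule allI)
    then obtain L where L: "\<And>s t. t \<in> S \<Longrightarrow> poly (L s) t = (if t = s then 1 else 0)"
      by metis
    have lagrange: "op_poly q A = (\<Sum>s\<in>S. poly q s *\<^sub>R op_poly (L s) A)" for q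
    proof -
      have "root_poly S dvd q - (\<Sum>s\<in>S. smult (poly q s) (L s))"
        using S(1) by (intro root_poly_dvd) (simp_all add: poly_sum L if_distrib sum.delta cong: if_cong)
      then have "op_poly (q - (\<Sum>s\<in>S. smult (poly q s) (L s))) A = 0"
        using S(2) by (rule op_poly_dvd_eq_0)
      then show ?thesis
        by (simp add: op_poly_diff op_poly_sum op_poly_smult)
    qed
    have "(\<lambda>j. \<Sum>s\<in>S. poly (p j) s *\<^sub>R op_poly (L s) A)
        \<longlonglongrightarrow> (\<Sum>s\<in>S. poly g s *\<^sub>R op_poly (L s) A)"
      using tendsto_uniform_limitI[OF lim] by (intro tendsto_intros) (simp add: S(3) g)
    then show "(\<lambda>j. op_poly (p j) A) \<longlonglongrightarrow> op_poly g A"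
      by (simp flip: lagrange)
  qed
next
  fix B
  assume B: "\<forall>p. uniform_limit (op_spectrum A) (\<lambda>j. poly (p j)) f sequentially \<longrightarrow>
      (\<lambda>j. op_poly (p j) A) \<longlonglongrightarrow> B"
  \<comment> \<open>The constant sequence \<open>g\<close> is admissible and forces the value of any
    candidate \<open>B\<close>.\<close>
  have "uniform_limit (op_spectrum A) (\<lambda>j::nat. poly g) f sequentially"
    using g by (intro uniform_limitI) (simp add: S(3))
  then have "(\<lambda>j::nat. op_poly g A) \<longlonglongrightarrow> B"
    using B[rule_format, of "\<lambda>_. g"] by simp
  then show "B = op_poly g A"
    by (simp add: LIMSEQ_const_iff)
qed

text \<open>An interpolant \<open>g\<close> of \<open>sqrt s ^ k\<close> represents the half power.
  Positivity makes the eigenvalues nonnegative, so \<open>g * g\<close> takes the values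
  \<open>s ^ k\<close>, and symmetry moves one factor across the inner product.\<close>

lemma (in symmetric_op) inner_op_half_power:
  assumes pos: "\<And>v. 0 \<le> A v \<bullet> v"
    and p: "p \<noteq> 0" "op_poly p A = 0"
  shows "op_half_power A k v \<bullet> op_half_power A k w = op_power A k v \<bullet> w"
proof -
  obtain S where S: "finite S" "op_poly (root_poly S) A = 0"
    and eigen: "\<And>s. s \<in> S \<Longrightarrow> \<exists>v. v \<noteq> 0 \<and> A v = s *\<^sub>R v"
    using annihilating_eigenvalues[OF p] by blast
  have spectrum: "op_spectrum A = S"
    using op_spectrum_subset_roots[OF S] eigen eigenvalue_in_spectrum by blast
  have nonneg: "0 \<le> s" if s: "s \<in> S" for s
  proof -
    obtain v where v: "v \<noteq> 0" "A v = s *\<^sub>R v"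
      using eigen[OF s] by blast
    then show ?thesis
      using pos[of v] by (simp add: zero_le_mult_iff)
        (metis inner_gt_zero_iff less_le_not_le)
  qed
  obtain g where g: "\<And>s. s \<in> S \<Longrightarrow> poly g s = sqrt s ^ k"
    using poly_interpolation[OF S(1), of "\<lambda>s. sqrt s ^ k"] by blast
  have half: "op_half_power A k = op_poly g A"
    unfolding op_half_power_def using S spectrum g by (rule fun_calc_eq_op_poly)
  have "root_poly S dvd g * g - monom 1 k"
    using S(1) by (rule root_poly_dvd)
      (simp add: g poly_monom nonneg flip: power_mult_distrib)
  then have "op_poly (g * g - monom 1 k) A = 0"
    using S(2) by (rule op_poly_dvd_eq_0)
  then have "op_power A k = op_poly g A o\<^sub>L op_poly g A"
    by (simp add: op_poly_diff op_poly_monom op_poly_mult)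
  then show ?thesis
    by (simp add: half symmetric_op_poly)
qed

section \<open>The ideal operator\<close>

text \<open>Collects the properties of the Gauss kernel on which the comparison rests. The lower
  bound \<open>c\<close> keeps \<open>ideal_mu K P\<close> away from \<open>0\<close>, which bounds
  the normalized features.\<close>

locale normalized_kernel = prob_space P
  for P :: "'a measure" +
  fixes K :: "'a \<Rightarrow> 'a \<Rightarrow> real"
    and \<phi> :: "'a \<Rightarrow> 'h::{real_inner,banach,second_countable_topology}"
    and c :: real
  assumes measurable_feature [measurable]: "\<phi> \<in> borel_measurable P"
    and kernel_eq: "x \<in> space P \<Longrightarrow> y \<in> space P \<Longrightarrow> K x y = \<phi> x \<bullet> \<phi> y"
    and norm_feature: "x \<in> space P \<Longrightarrow> norm (\<phi> x) = 1"
    and c_pos: "0 < c"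
    and kernel_ge: "x \<in> space P \<Longrightarrow> y \<in> space P \<Longrightarrow> c \<le> K x y"
begin

abbreviation "\<mu> \<equiv> ideal_mu K P"
abbreviation "\<psi> \<equiv> normalized_feature \<mu> \<phi>"
abbreviation "G \<equiv> ideal_op K \<phi> P"

lemma integrable_bounded_on_space:
  fixes f :: "'a \<Rightarrow> 'b::{banach,second_countable_topology}"
  assumes "f \<in> borel_measurable P" "\<And>x. x \<in> space P \<Longrightarrow> norm (f x) \<le> B"
  shows "integrable P f"
  using assms by (intro integrable_const_bound[of _ B]) auto

lemma integrable_feature: "integrable P \<phi>"
  by (rule integrable_bounded_on_space[of _ 1]) (simp_all add: norm_feature)

text \<open>Integration commutes with the inner product, so \<open>\<mu>\<close> is the pairing with
  the mean embedding of \<open>P\<close>; its measurability follows.\<close>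

lemma mu_eq:
  assumes "x \<in> space P"
  shows "\<mu> x = \<phi> x \<bullet> (LINT z|P. \<phi> z)"
proof -
  have "\<mu> x = (LINT z|P. \<phi> x \<bullet> \<phi> z)"
    unfolding ideal_mu_def using assms by (intro Bochner_Integration.integral_cong) (simp_all add: kernel_eq)
  then show ?thesis
    using integrable_feature by simp
qed

lemma mu_ge:
  assumes "x \<in> space P"
  shows "c \<le> \<mu> x"
proof -
  have "integrable P (K x)"
    using assms integrable_feature
    by (subst Bochner_Integration.integrable_cong[OF refl, of _ _ "\<lambda>z. \<phi> x \<bullet> \<phi> z"]) (simp_all add: kernel_eq)
  then have "(LINT z|P. c) \<le> (LINT z|P. K x z)"
    using assms by (intro integral_mono) (simp_all add: kernel_ge)
  then show ?thesis
    by (simp add: ideal_mu_def prob_space)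
qed

lemma mu_pos: "x \<in> space P \<Longrightarrow> 0 < \<mu> x"
  using mu_ge[of x] c_pos by linarith

lemma measurable_mu [measurable]: "\<mu> \<in> borel_measurable P"
  by (subst measurable_cong[OF mu_eq]) simp_all

lemma measurable_normalized_feature [measurable]: "\<psi> \<in> borel_measurable P"
  unfolding normalized_feature_def by measurable

lemma norm_normalized_feature: "x \<in> space P \<Longrightarrow> norm (\<psi> x) = 1 / sqrt (\<mu> x)"
  using mu_pos[of x] by (simp add: normalized_feature_def norm_feature)

lemma norm_normalized_feature_le: "x \<in> space P \<Longrightarrow> norm (\<psi> x) \<le> 1 / sqrt c"
  using mu_ge[of x] c_pos by (simp add: norm_normalized_feature frac_le)

lemma abs_inner_normalized_feature_le:
  "x \<in> space P \<Longrightarrow> \<bar>v \<bullet> \<psi> x\<bar> \<le> norm v * (1 / sqrt c)"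
  using order_trans[OF Cauchy_Schwarz_ineq2 mult_left_mono[OF norm_normalized_feature_le]]
  by simp

lemma ideal_kernel_eq:
  "x \<in> space P \<Longrightarrow> y \<in> space P \<Longrightarrow> ideal_kernel K P x y = \<psi> x \<bullet> \<psi> y"
  by (simp add: ideal_kernel_def normalized_feature_def kernel_eq)

lemma integrable_ideal_op: "integrable P (\<lambda>z. (v \<bullet> \<psi> z) *\<^sub>R \<psi> z)"
proof (rule integrable_bounded_on_space)
  fix z
  assume z: "z \<in> space P"
  have "\<bar>v \<bullet> \<psi> z\<bar> * norm (\<psi> z) \<le> (norm v * (1 / sqrt c)) * (1 / sqrt c)"
    using z c_pos
    by (intro mult_mono abs_inner_normalized_feature_le norm_normalized_feature_le) simp_all
  then show "norm ((v \<bullet> \<psi> z) *\<^sub>R \<psi> z) \<le> (norm v * (1 / sqrt c)) * (1 / sqrt c)"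
    by simp
qed measurable

lemma integrable_inner_mult_inner: "integrable P (\<lambda>z. (v \<bullet> \<psi> z) * (w \<bullet> \<psi> z))"
  using integrable_inner_left[OF integrable_ideal_op, of w v]
  by (simp add: inner_commute mult.commute)

text \<open>\<open>Blinfun\<close> has its intended value only on bounded linear maps. The crude
  bound \<open>1 / c\<close> serves for this; the bound \<open>1\<close> comes later from Schur's
  test.\<close>

lemma ideal_op_apply: "G v = (LINT z|P. (v \<bullet> \<psi> z) *\<^sub>R \<psi> z)"
proof -
  have "bounded_linear (\<lambda>v. LINT z|P. (v \<bullet> \<psi> z) *\<^sub>R \<psi> z)"
  proof (rule bounded_linear_intro)
    fix v w :: 'h and r :: real
    show "(LINT z|P. ((v + w) \<bullet> \<psi> z) *\<^sub>R \<psi> z) =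
        (LINT z|P. (v \<bullet> \<psi> z) *\<^sub>R \<psi> z) + (LINT z|P. (w \<bullet> \<psi> z) *\<^sub>R \<psi> z)"
      by (simp add: inner_add_left scaleR_add_left integrable_ideal_op)
    show "(LINT z|P. ((r *\<^sub>R v) \<bullet> \<psi> z) *\<^sub>R \<psi> z) = r *\<^sub>R (LINT z|P. (v \<bullet> \<psi> z) *\<^sub>R \<psi> z)"
      by (simp flip: scaleR_scaleR)
    have "norm (LINT z|P. (v \<bullet> \<psi> z) *\<^sub>R \<psi> z) \<le> (LINT z|P. norm ((v \<bullet> \<psi> z) *\<^sub>R \<psi> z))"
      by (rule integral_norm_bound)
    also have "\<dots> \<le> (LINT z|P. norm v * ((1 / sqrt c) * (1 / sqrt c)))"
    proof (rule integral_mono)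
      fix z
      assume z: "z \<in> space P"
      have "\<bar>v \<bullet> \<psi> z\<bar> * norm (\<psi> z) \<le> (norm v * (1 / sqrt c)) * (1 / sqrt c)"
        using z c_pos
        by (intro mult_mono abs_inner_normalized_feature_le norm_normalized_feature_le) simp_all
      then show "norm ((v \<bullet> \<psi> z) *\<^sub>R \<psi> z) \<le> norm v * ((1 / sqrt c) * (1 / sqrt c))"
        by simp
    qed (intro integrable_norm integrable_ideal_op, simp)
    finally show "norm (LINT z|P. (v \<bullet> \<psi> z) *\<^sub>R \<psi> z) \<le> norm v * ((1 / sqrt c) * (1 / sqrt c))"
      by (simp add: prob_space)
  qed
  then show ?thesis
    unfolding ideal_op_def by (simp add: bounded_linear_Blinfun_apply)
qed

lemma inner_ideal_op: "G v \<bullet> w = (LINT z|P. (v \<bullet> \<psi> z) * (w \<bullet> \<psi> z))"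
proof -
  have "G v \<bullet> w = (LINT z|P. ((v \<bullet> \<psi> z) *\<^sub>R \<psi> z) \<bullet> w)"
    by (simp only: ideal_op_apply integral_inner_left[OF integrable_ideal_op])
  then show ?thesis
    by (simp add: inner_commute)
qed

text \<open>
  Schur's test for \<open>ideal_kernel K P\<close>: with \<open>a = v \<bullet> \<psi> z / sqrt (\<mu> z)\<close> and \<open>b\<close> the same at \<open>t\<close>,
  bound \<open>a b\<close> by \<open>(a\<^sup>2 + b\<^sup>2) / 2\<close> and integrate \<open>K z t\<close> over the free variable.
\<close>

lemma inner_ideal_op_self_le: "G v \<bullet> G v \<le> G v \<bullet> v"
proof -
  define f where "f z = v \<bullet> \<psi> z" for z
  define g where "g z = (f z)\<^sup>2 / \<mu> z" for z
  define B where "B = norm v * (1 / sqrt c)"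
  have [measurable]: "f \<in> borel_measurable P" "g \<in> borel_measurable P"
    unfolding f_def g_def by measurable
  have f_bound: "\<bar>f z\<bar> \<le> B" if "z \<in> space P" for z
    using abs_inner_normalized_feature_le[OF that] by (simp add: f_def B_def)
  then have f2_bound: "(f z)\<^sup>2 \<le> B\<^sup>2" if "z \<in> space P" for z
    using that by (metis abs_ge_zero power2_abs power_mono)
  then have g_bound: "\<bar>g z\<bar> \<le> B\<^sup>2 / c" if "z \<in> space P" for z
    using that mu_ge[OF that] c_pos by (simp add: g_def frac_le)
  have int_f2: "integrable P (\<lambda>z. (f z)\<^sup>2)"
    by (rule integrable_bounded_on_space[of _ "B\<^sup>2"]) (simp_all add: f2_bound)
  have int_g\<phi>: "integrable P (\<lambda>t. g t *\<^sub>R \<phi> t)"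
    by (rule integrable_bounded_on_space[of _ "B\<^sup>2 / c"]) (simp_all add: g_bound norm_feature)
  \<comment> \<open>This vector encodes the integral of \<open>K z t * g t\<close> over
    \<open>t\<close> as \<open>\<phi> z \<bullet> w\<close>; exchanging the two integrations becomes
    linearity of the inner product.\<close>
  define w where "w = (LINT t|P. g t *\<^sub>R \<phi> t)"
  have inner_le: "f z * (G v \<bullet> \<psi> z) \<le> ((f z)\<^sup>2 + \<phi> z \<bullet> w) / 2" if z: "z \<in> space P" for z
  proof -
    have "f z * (G v \<bullet> \<psi> z) = (LINT t|P. f z * ((v \<bullet> \<psi> t) * (\<psi> z \<bullet> \<psi> t)))"
      by (simp add: inner_ideal_op)
    also have "\<dots> \<le> (LINT t|P. ((g z *\<^sub>R \<phi> z) \<bullet> \<phi> t + \<phi> z \<bullet> (g t *\<^sub>R \<phi> t)) / 2)"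
    proof (rule integral_mono)
      show "integrable P (\<lambda>t. f z * ((v \<bullet> \<psi> t) * (\<psi> z \<bullet> \<psi> t)))"
        by (simp add: integrable_inner_mult_inner)
      show "integrable P (\<lambda>t. ((g z *\<^sub>R \<phi> z) \<bullet> \<phi> t + \<phi> z \<bullet> (g t *\<^sub>R \<phi> t)) / 2)"
        by (intro integrable_divide Bochner_Integration.integrable_add integrable_inner_right
            integrable_feature int_g\<phi>)
      fix t
      assume t: "t \<in> space P"
      define a b where "a = f z / sqrt (\<mu> z)" and "b = f t / sqrt (\<mu> t)"
      have "f z * ((v \<bullet> \<psi> t) * (\<psi> z \<bullet> \<psi> t)) = (a * b) * K z t"
        using z t by (simp add: a_def b_def ideal_kernel_def flip: f_def ideal_kernel_eq)
      also have "\<dots> \<le> ((a\<^sup>2 + b\<^sup>2) / 2) * K z t"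
        using kernel_ge[OF z t] c_pos sum_squares_bound[of a b] by (intro mult_right_mono) simp_all
      also have "\<dots> = ((g z + g t) / 2) * K z t"
        using mu_pos[OF z] mu_pos[OF t] by (simp add: a_def b_def g_def power_divide)
      also have "\<dots> = ((g z *\<^sub>R \<phi> z) \<bullet> \<phi> t + \<phi> z \<bullet> (g t *\<^sub>R \<phi> t)) / 2"
        using z t by (simp add: kernel_eq algebra_simps)
      finally show "f z * ((v \<bullet> \<psi> t) * (\<psi> z \<bullet> \<psi> t)) \<le>
          ((g z *\<^sub>R \<phi> z) \<bullet> \<phi> t + \<phi> z \<bullet> (g t *\<^sub>R \<phi> t)) / 2" .
    qed
    also have "\<dots> = ((g z *\<^sub>R \<phi> z) \<bullet> (LINT t|P. \<phi> t) + \<phi> z \<bullet> w) / 2"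
      unfolding w_def
      by (subst integral_divide_zero, subst Bochner_Integration.integral_add)
        (simp_all only: integral_inner_right integrable_inner_right integrable_feature int_g\<phi>)
    also have "\<dots> = ((f z)\<^sup>2 + \<phi> z \<bullet> w) / 2"
      using mu_pos[OF z] by (simp add: g_def flip: mu_eq[OF z])
    finally show ?thesis .
  qed
  have "G v \<bullet> G v = (LINT z|P. f z * (G v \<bullet> \<psi> z))"
    by (simp add: inner_ideal_op[of v] f_def)
  also have "\<dots> \<le> (LINT z|P. ((f z)\<^sup>2 + \<phi> z \<bullet> w) / 2)"
  proof (rule integral_mono)
    show "integrable P (\<lambda>z. f z * (G v \<bullet> \<psi> z))"
      unfolding f_def by (rule integrable_inner_mult_inner)
    show "integrable P (\<lambda>z. ((f z)\<^sup>2 + \<phi> z \<bullet> w) / 2)"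
      by (simp add: int_f2 integrable_feature)
  qed (rule inner_le)
  also have "\<dots> = ((LINT z|P. (f z)\<^sup>2) + (LINT z|P. \<phi> z) \<bullet> w) / 2"
    by (simp add: int_f2 integrable_feature)
  also have "(LINT z|P. \<phi> z) \<bullet> w = (LINT z|P. (LINT z|P. \<phi> z) \<bullet> (g z *\<^sub>R \<phi> z))"
    unfolding w_def by (simp only: integral_inner_right int_g\<phi>)
  also have "\<dots> = (LINT z|P. (f z)\<^sup>2)"
  proof (rule Bochner_Integration.integral_cong)
    fix z
    assume z: "z \<in> space P"
    have "(LINT z|P. \<phi> z) \<bullet> (g z *\<^sub>R \<phi> z) = g z * \<mu> z"
      by (simp add: mu_eq[OF z] inner_commute)
    then show "(LINT z|P. \<phi> z) \<bullet> (g z *\<^sub>R \<phi> z) = (f z)\<^sup>2"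
      using mu_pos[OF z] by (simp add: g_def)
  qed simp
  also have "((LINT z|P. (f z)\<^sup>2) + (LINT z|P. (f z)\<^sup>2)) / 2 = G v \<bullet> v"
    by (simp add: inner_ideal_op f_def power2_eq_square)
  finally show ?thesis .
qed

lemma norm_ideal_op_le: "norm G \<le> 1"
proof (rule norm_blinfun_bound)
  fix v
  have "norm (G v) * norm (G v) \<le> norm (G v) * norm v"
    using order_trans[OF inner_ideal_op_self_le norm_cauchy_schwarz]
    by (simp add: power2_norm_eq_inner flip: power2_eq_square)
  then show "norm (G v) \<le> 1 * norm v"
    by (cases "G v = 0") simp_all
qed simp

text \<open>The map from \<open>v\<close> to the function \<open>v \<bullet> \<psi> z\<close> of
  \<open>z\<close>, followed by its adjoint, is \<open>G\<close>; hence it is a contraction into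
  \<open>L\<^sup>2\<close>.\<close>

lemma integral_inner_normalized_feature_sq_le: "(LINT z|P. (v \<bullet> \<psi> z)\<^sup>2) \<le> (norm v)\<^sup>2"
proof -
  have "(LINT z|P. (v \<bullet> \<psi> z)\<^sup>2) = G v \<bullet> v"
    by (simp add: inner_ideal_op power2_eq_square)
  also have "\<dots> \<le> norm (G v) * norm v"
    by (rule norm_cauchy_schwarz)
  also have "\<dots> \<le> (1 * norm v) * norm v"
    using order_trans[OF norm_blinfun mult_right_mono[OF norm_ideal_op_le]]
    by (intro mult_right_mono) simp_all
  finally show ?thesis
    by (simp add: power2_eq_square)
qed

section \<open>The iterated ideal kernel and powers of the ideal operator\<close>

text \<open>Integrating out the last variable turns the pairing with \<open>v\<close> into one with
  \<open>G v\<close>. An arbitrary end vector in place of a feature lets the induction absorb this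
  \<open>G\<close>.\<close>

lemma integral_ideal_kernel_chain:
  fixes y :: 'a
  assumes y: "y \<in> space P"
  shows "(LINT z|PiM {1..<Suc k} (\<lambda>_. P). (\<Prod>i<k. \<psi> ((z(0 := y)) i) \<bullet> \<psi> ((z(0 := y)) (Suc i)))
      * (\<psi> ((z(0 := y)) k) \<bullet> v)) = \<psi> y \<bullet> op_power G k v"
proof (induction k arbitrary: v)
  case 0
  show ?case
    by (simp add: PiM_empty)
next
  case (Suc k)
  interpret product_sigma_finite "\<lambda>_::nat. P" ..
  define I where "I = {1..<Suc k}"
  define E where "E z = (\<Prod>i<k. \<psi> ((z(0 := y)) i) \<bullet> \<psi> ((z(0 := y)) (Suc i)))"
    for z :: "nat \<Rightarrow> 'a"
  define F where "F z = (\<Prod>i<Suc k. \<psi> ((z(0 := y)) i) \<bullet> \<psi> ((z(0 := y)) (Suc i)))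
      * (\<psi> ((z(0 := y)) (Suc k)) \<bullet> v)" for z :: "nat \<Rightarrow> 'a"
  interpret PI: prob_space "PiM {1..<Suc (Suc k)} (\<lambda>_::nat. P)"
    by (rule prob_space_PiM) (rule prob_space_axioms)
  have point: "(\<lambda>z. (z(0 := y)) i) \<in> measurable (PiM {1..<Suc (Suc k)} (\<lambda>_. P)) P"
    if "i \<le> Suc k" for i
    using that y by (cases "i = 0") simp_all
  have meas: "(\<lambda>z. \<psi> ((z(0 := y)) i)) \<in> borel_measurable (PiM {1..<Suc (Suc k)} (\<lambda>_. P))"
    if "i \<le> Suc k" for i
    using measurable_compose[OF point[OF that] measurable_normalized_feature] .
  have "integrable (PiM {1..<Suc (Suc k)} (\<lambda>_. P)) F"
  proof (rule PI.integrable_const_bound)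
    show "F \<in> borel_measurable (PiM {1..<Suc (Suc k)} (\<lambda>_. P))"
      unfolding F_def
      by (intro borel_measurable_times borel_measurable_prod borel_measurable_inner meas
          borel_measurable_const) simp_all
    have "norm (F z) \<le> (\<Prod>i<Suc k. (1 / sqrt c) * (1 / sqrt c)) * ((1 / sqrt c) * norm v)"
      if z: "z \<in> space (PiM {1..<Suc (Suc k)} (\<lambda>_. P))" for z
    proof -
      have b: "norm (\<psi> ((z(0 := y)) i)) \<le> 1 / sqrt c" if "i \<le> Suc k" for i
        using measurable_space[OF point[OF that] z] by (rule norm_normalized_feature_le)
      have "\<bar>F z\<bar> = (\<Prod>i<Suc k. \<bar>\<psi> ((z(0 := y)) i) \<bullet> \<psi> ((z(0 := y)) (Suc i))\<bar>)
          * \<bar>\<psi> ((z(0 := y)) (Suc k)) \<bullet> v\<bar>"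
        by (simp only: F_def abs_mult abs_prod)
      also have "\<dots> \<le> (\<Prod>i<Suc k. (1 / sqrt c) * (1 / sqrt c)) * ((1 / sqrt c) * norm v)"
      proof (intro mult_mono prod_mono prod_nonneg conjI)
        show "\<bar>\<psi> ((z(0 := y)) i) \<bullet> \<psi> ((z(0 := y)) (Suc i))\<bar> \<le> (1 / sqrt c) * (1 / sqrt c)"
          if "i \<in> {..<Suc k}" for i
          using that c_pos by (intro order_trans[OF Cauchy_Schwarz_ineq2] mult_mono b) simp_all
        show "\<bar>\<psi> ((z(0 := y)) (Suc k)) \<bullet> v\<bar> \<le> (1 / sqrt c) * norm v"
          by (intro order_trans[OF Cauchy_Schwarz_ineq2] mult_right_mono b) simp_all
      qed (use c_pos in simp_all)
      finally show ?thesis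
        by simp
    qed
    then show "AE z in PiM {1..<Suc (Suc k)} (\<lambda>_. P). norm (F z) \<le>
        (\<Prod>i<Suc k. (1 / sqrt c) * (1 / sqrt c)) * ((1 / sqrt c) * norm v)"
      by (rule AE_I2)
  qed
  moreover have "{1..<Suc (Suc k)} = insert (Suc k) I"
    by (auto simp: I_def)
  ultimately have "(LINT z|PiM {1..<Suc (Suc k)} (\<lambda>_. P). F z) =
      (LINT z|PiM I (\<lambda>_. P). LINT t|P. F (z(Suc k := t)))"
    by (simp add: product_integral_insert I_def)
  also have "\<dots> = (LINT z|PiM I (\<lambda>_. P). E z * (\<psi> ((z(0 := y)) k) \<bullet> G v))"
  proof (rule Bochner_Integration.integral_cong)
    fix z
    have "F (z(Suc k := t)) =
        E z * ((v \<bullet> \<psi> t) * (\<psi> ((z(0 := y)) k) \<bullet> \<psi> t))" for t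
    proof -
      \<comment> \<open>These factors involve indices up to \<open>k\<close> only and do not see the
        update at \<open>Suc k\<close>.\<close>
      have "(\<Prod>i<k. \<psi> ((z(Suc k := t, 0 := y)) i) \<bullet> \<psi> ((z(Suc k := t, 0 := y)) (Suc i))) = E z"
        unfolding E_def by (intro prod.cong) auto
      then show ?thesis
        by (simp add: F_def inner_commute)
    qed
    then show "(LINT t|P. F (z(Suc k := t))) = E z * (\<psi> ((z(0 := y)) k) \<bullet> G v)"
      by (simp add: inner_ideal_op inner_commute[of _ "G v"])
  qed simp
  also have "\<dots> = \<psi> y \<bullet> op_power G k (G v)"
    unfolding I_def E_def by (rule Suc.IH)
  also have "\<dots> = \<psi> y \<bullet> op_power G (Suc k) v"
    by (simp only: op_power_Suc_apply)
  finally show ?case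
    unfolding F_def .
qed

text \<open>Order \<open>Suc k\<close> has \<open>k\<close> integration variables, hence the power
  \<open>k\<close> of \<open>G\<close>; the last kernel factor supplies the end vector
  \<open>\<psi> x\<close>.\<close>

lemma ideal_kernel_iter_eq:
  assumes x: "x \<in> space P" and y: "y \<in> space P"
  shows "ideal_kernel_iter K P (Suc k) x y = op_power G k (\<psi> x) \<bullet> \<psi> y"
proof -
  have "ideal_kernel_iter K P (Suc k) x y =
      (LINT z|PiM {1..<Suc k} (\<lambda>_. P). (\<Prod>i<k. \<psi> ((z(0 := y)) i) \<bullet> \<psi> ((z(0 := y)) (Suc i)))
      * (\<psi> ((z(0 := y)) k) \<bullet> \<psi> x))"
    unfolding ideal_kernel_iter_def Let_def
  proof (rule Bochner_Integration.integral_cong)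
    fix z
    assume z: "z \<in> space (PiM {1..<Suc k} (\<lambda>_. P))"
    define w where "w = z(0 := y, Suc k := x)"
    have w: "w i \<in> space P" if "i \<le> Suc k" for i
      using z x y that by (auto simp: w_def space_PiM PiE_iff)
    have "(\<Prod>i<Suc k. ideal_kernel K P (w i) (w (Suc i))) = (\<Prod>i<Suc k. \<psi> (w i) \<bullet> \<psi> (w (Suc i)))"
      by (intro prod.cong) (auto simp: ideal_kernel_eq w)
    also have "\<dots> = (\<Prod>i<k. \<psi> (w i) \<bullet> \<psi> (w (Suc i))) * (\<psi> (w k) \<bullet> \<psi> x)"
      by (simp add: w_def)
    also have "\<dots> = (\<Prod>i<k. \<psi> ((z(0 := y)) i) \<bullet> \<psi> ((z(0 := y)) (Suc i)))
        * (\<psi> ((z(0 := y)) k) \<bullet> \<psi> x)"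
      by (intro arg_cong2[of _ _ _ _ "(*)"] prod.cong) (auto simp: w_def)
    finally show "(\<Prod>i<Suc k. ideal_kernel K P (w i) (w (Suc i))) =
        (\<Prod>i<k. \<psi> ((z(0 := y)) i) \<bullet> \<psi> ((z(0 := y)) (Suc i))) * (\<psi> ((z(0 := y)) k) \<bullet> \<psi> x)" .
  qed simp
  also have "\<dots> = \<psi> y \<bullet> op_power G k (\<psi> x)"
    using y by (rule integral_ideal_kernel_chain)
  finally show ?thesis
    by (simp add: inner_commute)
qed

end

section \<open>Perturbation of powers\<close>

lemma norm_op_power_le:
  assumes "norm A \<le> 1"
  shows "norm (op_power A k) \<le> 1"
proof (induction k)
  case 0
  show ?case
    by (rule norm_blinfun_bound) simp_all
next
  case (Suc k)
  have "norm (op_power A (Suc k)) \<le> norm A * norm (op_power A k)"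
    by (simp add: norm_blinfun_compose)
  also have "\<dots> \<le> 1 * 1"
    using assms Suc by (intro mult_mono) simp_all
  finally show ?case by simp
qed

text \<open>Telescoping exchanges one factor at a time: \<open>norm A\<close> is at most
  \<open>1 + norm (A - B)\<close>, while powers of \<open>B\<close> have norm at most
  \<open>1\<close>.\<close>

lemma norm_op_power_diff_le:
  assumes B: "norm B \<le> 1"
  shows "norm (op_power A (Suc k) - op_power B (Suc k)) \<le>
    real (Suc k) * norm (A - B) * (1 + norm (A - B)) ^ k"
proof (induction k)
  case 0
  have "op_power A (Suc 0) - op_power B (Suc 0) = A - B"
    by (rule blinfun_eqI) (simp add: blinfun.bilinear_simps)
  then show ?case by simp
next
  case (Suc k)
  define d where "d = norm (A - B)"
  have "0 \<le> d"
    by (simp add: d_def)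
  have A: "norm A \<le> 1 + d"
    using norm_triangle_ineq[of "A - B" B] B by (simp add: d_def)
  have "op_power A (Suc (Suc k)) - op_power B (Suc (Suc k)) =
      (A o\<^sub>L (op_power A (Suc k) - op_power B (Suc k))) + ((A - B) o\<^sub>L op_power B (Suc k))"
    by (rule blinfun_eqI) (simp add: blinfun.bilinear_simps)
  also have "norm \<dots> \<le> norm A * norm (op_power A (Suc k) - op_power B (Suc k))
      + d * norm (op_power B (Suc k))"
    unfolding d_def by (intro norm_triangle_le add_mono norm_blinfun_compose)
  also have "\<dots> \<le> (1 + d) * (real (Suc k) * d * (1 + d) ^ k) + d * 1"
    using A Suc.IH \<open>0 \<le> d\<close> norm_op_power_le[OF B, of "Suc k"]
    unfolding d_def by (intro add_mono mult_mono) simp_all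
  also have "\<dots> \<le> real (Suc k) * d * (1 + d) ^ Suc k + d * (1 + d) ^ Suc k"
    using \<open>0 \<le> d\<close> one_le_power[of "1 + d" "Suc k"]
    by (intro add_mono mult_left_mono) simp_all
  also have "\<dots> = real (Suc (Suc k)) * d * (1 + d) ^ Suc k"
    by (simp add: algebra_simps)
  finally show ?case
    unfolding d_def .
qed

section \<open>The empirical operator\<close>

lemma emp_op_symmetric: "symmetric_op (emp_op K \<phi> n X)"
  by standard (simp add: emp_op_apply inner_sum_left inner_sum_right inner_commute mult_ac)

text \<open>The range lies in the span of the finitely many sample features.\<close>

lemma emp_op_annihilating_poly:
  "\<exists>p. p \<noteq> 0 \<and> op_poly p (emp_op K \<phi> n X) = 0"
proof (rule finite_rank_annihilating_poly)
  show "finite ((\<lambda>i. \<phi> (X i)) ` {1..n})"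
    by simp
  show "emp_op K \<phi> n X v \<in> span ((\<lambda>i. \<phi> (X i)) ` {1..n})" for v
    unfolding emp_op_apply by (intro span_scale span_sum span_base) simp
qed

lemma emp_op_nonneg:
  assumes "\<And>i. i \<in> {1..n} \<Longrightarrow> 0 \<le> emp_mu K n X (X i)"
  shows "0 \<le> emp_op K \<phi> n X v \<bullet> v"
proof -
  have "emp_op K \<phi> n X v \<bullet> v =
      (1 / real n) * (\<Sum>i=1..n. (1 / emp_mu K n X (X i)) * (v \<bullet> \<phi> (X i))\<^sup>2)"
    by (simp add: emp_op_apply inner_sum_left inner_sum_right inner_commute power2_eq_square)
  also have "0 \<le> \<dots>"
    using assms by (intro mult_nonneg_nonneg sum_nonneg divide_nonneg_nonneg) auto
  finally show ?thesis .
qed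

text \<open>The two half powers combine to the full power \<open>k\<close>, one less than the
  order.\<close>

lemma emp_kernel_iter_eq:
  assumes "\<And>i. i \<in> {1..n} \<Longrightarrow> 0 \<le> emp_mu K n X (X i)"
  shows "emp_kernel_iter K \<phi> n X (Suc k) x y =
    op_power (emp_op K \<phi> n X) k (normalized_feature (emp_mu K n X) \<phi> x)
      \<bullet> normalized_feature (emp_mu K n X) \<phi> y"
proof -
  interpret symmetric_op "emp_op K \<phi> n X"
    by (rule emp_op_symmetric)
  show ?thesis
    using emp_op_annihilating_poly[of K \<phi> n X] emp_op_nonneg[OF assms]
    by (auto simp: emp_kernel_iter_def intro: inner_op_half_power)
qed

section \<open>Comparison of the iterated kernels\<close>

context normalized_kernel
begin

text \<open>Cauchy-Schwarz in \<open>L\<^sup>2\<close> combined with the contraction property: after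
  normalizing by \<open>sgn\<close>, the inequality
  \<open>2 * a * b \<le> a\<^sup>2 + b\<^sup>2\<close> suffices.\<close>

lemma integral_abs_inner_mult_le: "(LINT z|P. \<bar>v \<bullet> \<psi> z\<bar> * \<bar>w \<bullet> \<psi> z\<bar>) \<le> norm v * norm w"
proof -
  have unit: "(LINT z|P. (sgn u \<bullet> \<psi> z)\<^sup>2) \<le> 1" for u
    using integral_inner_normalized_feature_sq_le[of "sgn u"]
    by (cases "u = 0") (simp_all add: norm_sgn)
  have int: "integrable P (\<lambda>z. (u \<bullet> \<psi> z)\<^sup>2)" for u
    using integrable_inner_mult_inner[of u u] by (simp add: power2_eq_square)
  have "(LINT z|P. \<bar>sgn v \<bullet> \<psi> z\<bar> * \<bar>sgn w \<bullet> \<psi> z\<bar>)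
      \<le> (LINT z|P. ((sgn v \<bullet> \<psi> z)\<^sup>2 + (sgn w \<bullet> \<psi> z)\<^sup>2) / 2)"
  proof (rule integral_mono')
    show "\<bar>sgn v \<bullet> \<psi> z\<bar> * \<bar>sgn w \<bullet> \<psi> z\<bar> \<le> ((sgn v \<bullet> \<psi> z)\<^sup>2 + (sgn w \<bullet> \<psi> z)\<^sup>2) / 2" for z
      using sum_squares_bound[of "\<bar>sgn v \<bullet> \<psi> z\<bar>" "\<bar>sgn w \<bullet> \<psi> z\<bar>"] by simp
  qed (simp_all add: int)
  also have "\<dots> \<le> 1"
    using unit[of v] unit[of w] by (simp add: int)
  finally have sgn: "(LINT z|P. \<bar>sgn v \<bullet> \<psi> z\<bar> * \<bar>sgn w \<bullet> \<psi> z\<bar>) \<le> 1" .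
  have scale: "\<bar>u \<bullet> \<psi> z\<bar> = norm u * \<bar>sgn u \<bullet> \<psi> z\<bar>" for u z
    by (cases "u = 0") (simp_all add: sgn_div_norm abs_mult)
  have "(LINT z|P. \<bar>v \<bullet> \<psi> z\<bar> * \<bar>w \<bullet> \<psi> z\<bar>) =
      (LINT z|P. (norm v * norm w) * (\<bar>sgn v \<bullet> \<psi> z\<bar> * \<bar>sgn w \<bullet> \<psi> z\<bar>))"
    by (simp only: scale[of v] scale[of w] mult_ac)
  also have "\<dots> = (norm v * norm w) * (LINT z|P. \<bar>sgn v \<bullet> \<psi> z\<bar> * \<bar>sgn w \<bullet> \<psi> z\<bar>)"
    by simp
  also have "\<dots> \<le> (norm v * norm w) * 1"
    using sgn by (intro mult_left_mono) simp_all
  finally show ?thesis by simp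
qed

lemma L2_norm_le:
  assumes f: "\<And>z. z \<in> space P \<Longrightarrow> \<bar>f z\<bar> \<le> \<bar>v \<bullet> \<psi> z\<bar> + \<bar>w \<bullet> \<psi> z\<bar>"
  shows "L2_norm P f \<le> norm v + norm w"
proof -
  have int: "integrable P (\<lambda>z. (u \<bullet> \<psi> z)\<^sup>2)" for u
    using integrable_inner_mult_inner[of u u] by (simp add: power2_eq_square)
  have int_abs: "integrable P (\<lambda>z. \<bar>v \<bullet> \<psi> z\<bar> * \<bar>w \<bullet> \<psi> z\<bar>)"
    using integrable_abs[OF integrable_inner_mult_inner[of v w]] by (simp add: abs_mult)
  have "(LINT z|P. (f z)\<^sup>2) \<le>
      (LINT z|P. (v \<bullet> \<psi> z)\<^sup>2 + (w \<bullet> \<psi> z)\<^sup>2 + 2 * (\<bar>v \<bullet> \<psi> z\<bar> * \<bar>w \<bullet> \<psi> z\<bar>))"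
  \<comment> \<open>If the square of \<open>f\<close> is not integrable, its integral is
    \<open>0\<close> by convention, which the nonnegative majorant still bounds.\<close>
  proof (rule integral_mono')
    fix z
    assume "z \<in> space P"
    then have "\<bar>f z\<bar>\<^sup>2 \<le> (\<bar>v \<bullet> \<psi> z\<bar> + \<bar>w \<bullet> \<psi> z\<bar>)\<^sup>2"
      using f by (intro power_mono) simp_all
    then show "(f z)\<^sup>2 \<le> (v \<bullet> \<psi> z)\<^sup>2 + (w \<bullet> \<psi> z)\<^sup>2 + 2 * (\<bar>v \<bullet> \<psi> z\<bar> * \<bar>w \<bullet> \<psi> z\<bar>)"
      by (simp add: power2_sum)
  qed (simp_all add: int int_abs)
  also have "\<dots> = (LINT z|P. (v \<bullet> \<psi> z)\<^sup>2) + (LINT z|P. (w \<bullet> \<psi> z)\<^sup>2)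
      + 2 * (LINT z|P. \<bar>v \<bullet> \<psi> z\<bar> * \<bar>w \<bullet> \<psi> z\<bar>)"
    by (simp add: int int_abs)
  also have "\<dots> \<le> (norm v)\<^sup>2 + (norm w)\<^sup>2 + 2 * (norm v * norm w)"
    by (intro add_mono integral_inner_normalized_feature_sq_le mult_left_mono
        integral_abs_inner_mult_le) simp_all
  also have "\<dots> = (norm v + norm w)\<^sup>2"
    by (simp add: power2_sum)
  finally show ?thesis
    unfolding L2_norm_def by (rule real_le_lsqrt[OF _ _, rotated -1]) simp_all
qed

text \<open>Applied with \<open>chi\<close> as \<open>h\<close> and the kernel difference as
  \<open>D\<close>. Both bounds come from one majorant, a sum of two absolute pairings of
  \<open>\<psi> y\<close> with vectors that depend on \<open>x\<close> only.\<close>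

lemma iterated_kernel_difference_bounds:
  fixes Q :: "'h \<Rightarrow>\<^sub>L 'h" and h :: "'a \<Rightarrow> real"
  assumes x: "x \<in> space P"
    and C: "1 \<le> C" "\<And>u. u \<in> space P \<Longrightarrow> \<bar>h u\<bar> \<le> C"
    and e: "\<And>u. u \<in> space P \<Longrightarrow> \<bar>h u - 1\<bar> \<le> e"
    and D: "\<And>y. y \<in> space P \<Longrightarrow>
      D y = op_power Q (Suc k) (h x *\<^sub>R \<psi> x) \<bullet> (h y *\<^sub>R \<psi> y) - op_power G (Suc k) (\<psi> x) \<bullet> \<psi> y"
  defines "R \<equiv> real (Suc k) * norm (Q - G) * (1 + norm (Q - G)) ^ k + 2 * e"
  shows "y \<in> space P \<Longrightarrow> \<bar>D y\<bar> \<le> C\<^sup>2 / (sqrt (\<mu> x) * sqrt (\<mu> y)) * R"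
    and "L2_norm P D \<le> C\<^sup>2 / sqrt (\<mu> x) * R"
proof -
  have "0 \<le> e"
    using e[OF x] by linarith
  define N where "N = real (Suc k) * norm (Q - G) * (1 + norm (Q - G)) ^ k"
  \<comment> \<open>\<open>v\<close> carries the change of operator and \<open>w\<close> the change
    of normalization; the bounds on \<open>h\<close> are built in to remove the dependence on
    \<open>y\<close>.\<close>
  define v where "v = C\<^sup>2 *\<^sub>R (op_power Q (Suc k) - op_power G (Suc k)) (\<psi> x)"
  define w where "w = (C\<^sup>2 * (2 * e)) *\<^sub>R op_power G (Suc k) (\<psi> x)"
  have split: "\<bar>D y\<bar> \<le> \<bar>v \<bullet> \<psi> y\<bar> + \<bar>w \<bullet> \<psi> y\<bar>" if y: "y \<in> space P" for y
  proof -
    define p where "p = (op_power Q (Suc k) - op_power G (Suc k)) (\<psi> x) \<bullet> \<psi> y"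
    define q where "q = op_power G (Suc k) (\<psi> x) \<bullet> \<psi> y"
    have "D y = (h x * h y) * p + (h x * h y - 1) * q"
      by (simp add: D[OF y] p_def q_def blinfun.bilinear_simps inner_diff_left algebra_simps
          del: op_power_Suc)
    then have "\<bar>D y\<bar> \<le> \<bar>h x * h y\<bar> * \<bar>p\<bar> + \<bar>h x * h y - 1\<bar> * \<bar>q\<bar>"
      using abs_triangle_ineq[of "(h x * h y) * p" "(h x * h y - 1) * q"] by (simp add: abs_mult)
    also have "\<dots> \<le> C\<^sup>2 * \<bar>p\<bar> + (C\<^sup>2 * (2 * e)) * \<bar>q\<bar>"
    proof (intro add_mono mult_right_mono)
      show "\<bar>h x * h y\<bar> \<le> C\<^sup>2"
        using C x y by (simp add: abs_mult power2_eq_square mult_mono)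
      have "h x * h y - 1 = h x * (h y - 1) + (h x - 1)"
        by (simp add: algebra_simps)
      then have "\<bar>h x * h y - 1\<bar> \<le> \<bar>h x\<bar> * \<bar>h y - 1\<bar> + \<bar>h x - 1\<bar>"
        by (metis abs_mult abs_triangle_ineq)
      also have "\<dots> \<le> C * e + 1 * e"
        using C x y e \<open>0 \<le> e\<close> by (intro add_mono mult_mono) simp_all
      \<comment> \<open>Since \<open>1 \<le> C\<close>, both terms can be raised to the common
        factor \<open>C\<^sup>2\<close>.\<close>
      also have "\<dots> \<le> C\<^sup>2 * e + C\<^sup>2 * e"
        using C(1) \<open>0 \<le> e\<close> power_increasing[of 1 2 C] one_le_power[of C 2]
        by (intro add_mono mult_right_mono) simp_all
      finally show "\<bar>h x * h y - 1\<bar> \<le> C\<^sup>2 * (2 * e)"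
        by (simp add: mult.commute mult.left_commute)
    qed simp_all
    also have "\<dots> = \<bar>v \<bullet> \<psi> y\<bar> + \<bar>w \<bullet> \<psi> y\<bar>"
      using \<open>0 \<le> e\<close> by (simp add: v_def w_def p_def q_def abs_mult del: op_power_Suc)
    finally show ?thesis .
  qed
  have "norm ((op_power Q (Suc k) - op_power G (Suc k)) (\<psi> x)) \<le> N * (1 / sqrt (\<mu> x))"
    unfolding N_def norm_normalized_feature[OF x, symmetric]
    by (intro order_trans[OF norm_blinfun] mult_right_mono norm_op_power_diff_le
        norm_ideal_op_le norm_ge_zero)
  then have "norm v \<le> C\<^sup>2 * (N * (1 / sqrt (\<mu> x)))"
    unfolding v_def norm_scaleR by (intro mult_mono) simp_all
  moreover have "norm (op_power G (Suc k) (\<psi> x)) \<le> 1 * (1 / sqrt (\<mu> x))"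
    unfolding norm_normalized_feature[OF x, symmetric]
    by (intro order_trans[OF norm_blinfun] mult_right_mono norm_op_power_le
        norm_ideal_op_le norm_ge_zero)
  then have "norm w \<le> (C\<^sup>2 * (2 * e)) * (1 * (1 / sqrt (\<mu> x)))"
    unfolding w_def norm_scaleR using \<open>0 \<le> e\<close> by (intro mult_mono) simp_all
  ultimately have "norm v + norm w \<le> C\<^sup>2 * (N * (1 / sqrt (\<mu> x)))
      + (C\<^sup>2 * (2 * e)) * (1 * (1 / sqrt (\<mu> x)))"
    by (rule add_mono)
  also have "\<dots> = C\<^sup>2 / sqrt (\<mu> x) * R"
    by (simp add: R_def N_def divide_inverse algebra_simps)
  finally have vw: "norm v + norm w \<le> C\<^sup>2 / sqrt (\<mu> x) * R" .
  show "\<bar>D y\<bar> \<le> C\<^sup>2 / (sqrt (\<mu> x) * sqrt (\<mu> y)) * R" if y: "y \<in> space P"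
  proof -
    have "\<bar>D y\<bar> \<le> \<bar>v \<bullet> \<psi> y\<bar> + \<bar>w \<bullet> \<psi> y\<bar>"
      by (rule split[OF y])
    also have "\<dots> \<le> norm v * norm (\<psi> y) + norm w * norm (\<psi> y)"
      by (intro add_mono Cauchy_Schwarz_ineq2)
    also have "\<dots> = (norm v + norm w) * (1 / sqrt (\<mu> y))"
      by (simp add: norm_normalized_feature[OF y] add_divide_distrib)
    also have "\<dots> \<le> (C\<^sup>2 / sqrt (\<mu> x) * R) * (1 / sqrt (\<mu> y))"
      using mu_pos[OF y] by (intro mult_right_mono vw) simp
    finally show ?thesis
      by (simp add: field_simps)
  qed
  show "L2_norm P D \<le> C\<^sup>2 / sqrt (\<mu> x) * R"
    using L2_norm_le[OF split] vw by (rule order_trans)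
qed

end

section \<open>The Gauss kernel on a compact set and the final estimate\<close>

text \<open>With \<open>d = dist x y\<close> the squared feature distance is
  \<open>2 - 2 * exp (- \<beta> * d\<^sup>2)\<close>, at most
  \<open>2 * \<beta> * d\<^sup>2\<close>. The resulting continuity makes the feature map
  measurable.\<close>

lemma gauss_feature_lipschitz:
  fixes \<phi> :: "'a::real_inner \<Rightarrow> 'h::real_inner"
  assumes "0 \<le> \<beta>"
    and "\<And>x y. x \<in> S \<Longrightarrow> y \<in> S \<Longrightarrow> \<phi> x \<bullet> \<phi> y = gauss_kernel \<beta> x y"
  shows "(sqrt (2 * \<beta>))-lipschitz_on S \<phi>"
proof (rule lipschitz_onI)
  fix x y
  assume xy: "x \<in> S" "y \<in> S"
  have "(dist (\<phi> x) (\<phi> y))\<^sup>2 = 2 - 2 * exp (- (\<beta> * (norm (x - y))\<^sup>2))"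
    using assms(2)[OF xy] assms(2)[OF xy(1) xy(1)] assms(2)[OF xy(2) xy(2)]
    by (simp add: dist_norm power2_norm_eq_inner inner_diff_left inner_diff_right
        inner_commute gauss_kernel_def)
  also have "\<dots> \<le> 2 * \<beta> * (dist x y)\<^sup>2"
    using exp_ge_add_one_self[of "- (\<beta> * (norm (x - y))\<^sup>2)"] by (simp add: dist_norm)
  also have "\<dots> = (sqrt (2 * \<beta>) * dist x y)\<^sup>2"
    using assms(1) by (simp add: power_mult_distrib)
  finally show "dist (\<phi> x) (\<phi> y) \<le> sqrt (2 * \<beta>) * dist x y"
    by (rule power2_le_imp_le) (use assms(1) in simp)
qed (use assms(1) in simp)

text \<open>The bound \<open>B\<close> ensures that the real supremum is taken over a set bounded
  above.\<close>

lemma sup_norm_upper: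
  assumes "x \<in> S" "\<And>u. u \<in> S \<Longrightarrow> \<bar>f u\<bar> \<le> B"
  shows "\<bar>f x\<bar> \<le> sup_norm S f"
  unfolding sup_norm_def using assms by (intro cSUP_upper bdd_aboveI2)

lemma emp_mu_ge:
  assumes "1 \<le> n" "\<And>i. i \<in> {1..n} \<Longrightarrow> c \<le> K x (X i)"
  shows "c \<le> emp_mu K n X x"
proof -
  have "real n * c \<le> (\<Sum>i=1..n. K x (X i))"
    using sum_bounded_below[of "{1..n}" c "\<lambda>i. K x (X i)"] assms(2) by simp
  then show ?thesis
    using assms(1) by (simp add: emp_mu_def pos_le_divide_eq mult.commute)
qed

theorem proposition8:
  fixes \<X> :: "'a::{real_inner,banach,second_countable_topology} set"
    and P :: "'a measure"
    and \<beta> :: real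
    and K :: "'a \<Rightarrow> 'a \<Rightarrow> real"
    and \<iota> :: "'h::{real_inner,banach,second_countable_topology} \<Rightarrow> 'a \<Rightarrow> real"
    and \<phi> :: "'a \<Rightarrow> 'h"
    and M :: "'w measure"
    and X :: "nat \<Rightarrow> 'w \<Rightarrow> 'a"
    and n m :: nat
    and \<omega> :: 'w
    and x :: 'a
    and \<mu> \<mu>h chi :: "'a \<Rightarrow> real"
    and Q G :: "'h \<Rightarrow>\<^sub>L 'h"
    and Kh Kbar :: "nat \<Rightarrow> 'a \<Rightarrow> 'a \<Rightarrow> real"
  assumes "compact \<X>"
    and "prob_space P"
    and "sets P = sets (restrict_space borel \<X>)"
    and "finite (components (measure_support P))"
    and "\<forall>C\<in>components (measure_support P). compact C"
    and "\<beta> > 0"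
    and "K = gauss_kernel \<beta>"
    and "is_rkhs \<X> K \<iota> \<phi>"
    and "prob_space M"
    and "n \<ge> 1"
    and "prob_space.indep_vars M (\<lambda>_. P) X {1..n}"
    and "\<forall>i\<in>{1..n}. distr M P (X i) = P"
    and "\<omega> \<in> space M"
  defines "\<mu> \<equiv> ideal_mu K P"
    and "\<mu>h \<equiv> emp_mu K n (\<lambda>i. X i \<omega>)"
    and "Q \<equiv> emp_op K \<phi> n (\<lambda>i. X i \<omega>)"
    and "G \<equiv> ideal_op K \<phi> P"
    and "Kh \<equiv> emp_kernel_iter K \<phi> n (\<lambda>i. X i \<omega>)"
    and "Kbar \<equiv> ideal_kernel_iter K P"
    and "chi \<equiv> (\<lambda>u. sqrt (\<mu> u / \<mu>h u))"
  assumes "x \<in> measure_support P"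
    and "m > 0"
  shows "(\<forall>y\<in>measure_support P.
            \<bar>Kh (2 * m) x y - Kbar (2 * m) x y\<bar>
            \<le> (max 1 (sup_norm \<X> chi))\<^sup>2 / (sqrt (\<mu> x) * sqrt (\<mu> y)) *
               ((2 * real m - 1) * norm (Q - G) * (1 + norm (Q - G)) ^ (2 * m - 2)
                + 2 * sup_norm \<X> (\<lambda>u. chi u - 1)))
       \<and> L2_norm P (\<lambda>y. Kh (2 * m) x y - Kbar (2 * m) x y)
            \<le> (max 1 (sup_norm \<X> chi))\<^sup>2 / sqrt (\<mu> x) *
               ((2 * real m - 1) * norm (Q - G) * (1 + norm (Q - G)) ^ (2 * m - 2)
                + 2 * sup_norm \<X> (\<lambda>u. chi u - 1))"
proof -
  let ?X = "\<lambda>i. X i \<omega>"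
  have space: "space P = \<X>"
    using sets_eq_imp_space_eq[OF assms(3)] by (simp add: space_restrict_space)
  have sample: "X i \<omega> \<in> \<X>" if "i \<in> {1..n}" for i
  proof -
    have "X i \<in> measurable M P"
      using assms(11) that by (simp add: prob_space.indep_vars_def[OF assms(9)])
    then show ?thesis
      using measurable_space[OF _ assms(13)] space by blast
  qed
  have kernel: "K u v = \<phi> u \<bullet> \<phi> v" if "u \<in> \<X>" "v \<in> \<X>" for u v
    using assms(8) that by (rule is_rkhs_kernel)
  obtain r where r: "\<And>u v. u \<in> \<X> \<Longrightarrow> v \<in> \<X> \<Longrightarrow> dist u v \<le> r"
    using compact_imp_bounded[OF assms(1)] by (auto simp: bounded_two_points)
  \<comment> \<open>The kernel value at distance \<open>r\<close>, where \<open>r\<close> bounds all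
    distances in the compact set.\<close>
  define c where "c = exp (- (\<beta> * r\<^sup>2))"
  have kernel_ge: "c \<le> K u v" if "u \<in> \<X>" "v \<in> \<X>" for u v
    using r[OF that] assms(6) power_mono[OF r[OF that], of 2]
    by (simp add: c_def assms(7) gauss_kernel_def dist_norm)
  have "continuous_on \<X> \<phi>"
    using gauss_feature_lipschitz[of \<beta> \<X> \<phi>] kernel assms(6,7)
    by (intro lipschitz_on_continuous_on[of "sqrt (2 * \<beta>)"]) simp
  then have "\<phi> \<in> borel_measurable P"
    using borel_measurable_continuous_on_restrict measurable_cong_sets[OF assms(3) refl] by blast
  moreover have "norm (\<phi> u) = 1" if "u \<in> \<X>" for u
    using kernel[OF that that] by (simp add: assms(7) gauss_kernel_def norm_eq_sqrt_inner)
  ultimately interpret nk: normalized_kernel P K \<phi> c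
    using assms(2) kernel kernel_ge
    by (intro normalized_kernel.intro normalized_kernel_axioms.intro) (simp_all add: space c_def)
  have muh_ge: "c \<le> \<mu>h u" if "u \<in> \<X>" for u
    unfolding \<mu>h_def using assms(10) kernel_ge[OF that sample] by (intro emp_mu_ge) simp_all
  \<comment> \<open>Numerator and denominator of \<open>chi\<close> are controlled by the norm of
    the mean embedding and by \<open>c\<close>. The bound only serves to make the two sup norms
    genuine.\<close>
  define B where "B = sqrt (norm (LINT z|P. \<phi> z) / c)"
  have chi_nonneg: "0 \<le> chi u" and chi_le: "chi u \<le> B" if u: "u \<in> \<X>" for u
  proof -
    have "\<mu> u \<le> norm (LINT z|P. \<phi> z)"
      using u norm_cauchy_schwarz[of "\<phi> u" "LINT z|P. \<phi> z"]
      by (simp add: \<mu>_def nk.mu_eq nk.norm_feature space)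
    then show "chi u \<le> B"
      using muh_ge[OF u] nk.c_pos by (simp add: chi_def B_def frac_le)
    show "0 \<le> chi u"
      using muh_ge[OF u] nk.mu_pos[of u] u nk.c_pos by (simp add: chi_def \<mu>_def space)
  qed
  have chi_bound: "\<bar>chi u\<bar> \<le> B" "\<bar>chi u - 1\<bar> \<le> B + 1" if "u \<in> \<X>" for u
    using chi_nonneg[OF that] chi_le[OF that] by auto
  have feature: "normalized_feature \<mu>h \<phi> u = chi u *\<^sub>R normalized_feature \<mu> \<phi> u" if u: "u \<in> \<X>" for u
    using nk.mu_pos[of u] u
    by (simp add: normalized_feature_def chi_def \<mu>_def space real_sqrt_divide)
  have "x \<in> \<X>"
    using assms(21) by (simp add: measure_support_def space)
  \<comment> \<open>The kernels of order \<open>2 * m\<close> involve the operator power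
    \<open>Suc k\<close>, that is \<open>2 * m - 1\<close>, and the perturbation bound has the
    exponent \<open>k\<close>.\<close>
  obtain k where k: "2 * m = Suc (Suc k)"
    using assms(22) by (cases m) auto
  have D: "Kh (2 * m) x y - Kbar (2 * m) x y =
      op_power Q (Suc k) (chi x *\<^sub>R normalized_feature \<mu> \<phi> x) \<bullet> (chi y *\<^sub>R normalized_feature \<mu> \<phi> y)
      - op_power G (Suc k) (normalized_feature \<mu> \<phi> x) \<bullet> normalized_feature \<mu> \<phi> y"
    if y: "y \<in> \<X>" for y
  proof -
    have nonneg: "0 \<le> emp_mu K n ?X (?X i)" if "i \<in> {1..n}" for i
      using muh_ge[OF sample[OF that]] nk.c_pos by (simp add: \<mu>h_def)
    have "Kh (2 * m) x y = op_power Q (Suc k) (normalized_feature \<mu>h \<phi> x)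
        \<bullet> normalized_feature \<mu>h \<phi> y"
      unfolding k Kh_def Q_def \<mu>h_def using nonneg by (rule emp_kernel_iter_eq)
    moreover have "Kbar (2 * m) x y = op_power G (Suc k) (normalized_feature \<mu> \<phi> x)
        \<bullet> normalized_feature \<mu> \<phi> y"
      unfolding k Kbar_def G_def \<mu>_def
      using \<open>x \<in> \<X>\<close> y by (intro nk.ideal_kernel_iter_eq) (simp_all add: space)
    ultimately show ?thesis
      by (simp only: feature \<open>x \<in> \<X>\<close> y)
  qed
  have factor: "2 * real m - 1 = real (Suc k)" "2 * m - 2 = k"
    using k by linarith+
  have "1 \<le> max 1 (sup_norm \<X> chi)"
    "\<And>u. u \<in> space P \<Longrightarrow> \<bar>chi u\<bar> \<le> max 1 (sup_norm \<X> chi)"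
    "\<And>u. u \<in> space P \<Longrightarrow> \<bar>chi u - 1\<bar> \<le> sup_norm \<X> (\<lambda>u. chi u - 1)"
    using sup_norm_upper[of _ \<X> chi, OF _ chi_bound(1)]
      sup_norm_upper[of _ \<X> "\<lambda>u. chi u - 1", OF _ chi_bound(2)]
    by (auto simp: space le_max_iff_disj)
  note bounds = nk.iterated_kernel_difference_bounds[OF _ this D[unfolded G_def \<mu>_def, folded space]]
  \<comment> \<open>The estimate holds on all of \<open>\<X>\<close>, the space of \<open>P\<close>,
    which contains the support.\<close>
  show ?thesis
    unfolding factor G_def \<mu>_def
    using bounds \<open>x \<in> \<X>\<close> by (auto simp only: space measure_support_def)
qed

end
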